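(* Let $n\ge 21$, $2\le s\le 2^{n-1}$ and $0\le i\le \binom{n}{2}$. Suppose that $\mathcal{A}\subset \mathcal{P}([n])$ is a family of size $\sum_{k=3}^n \binom{n}{k}+i$ of the form $[n]^{(\ge 3)}\cup \mathcal{B}$ with $\mathcal{B}\subset [n]^{(2)}$, and that among all families of this form and this size, $\mathcal{A}$ contains the maximal number of intersecting subfamilies of size $s$. Then $\mathcal{B}$ is a family of size $i$ contained in $[n]^{(2)}$ which contains the maximal number of intersecting (unordered) pairs $\{B,B'\}$, $B\neq B'$, $B\cap B'\ne\emptyset$, among all families of size $i$ contained in $[n]^{(2)}$.
   Context: $[n]=\{1,\dots,n\}$, $\mathcal{P}([n])$ is its power set, $[n]^{(r)}$ is the set of $r$-element subsets of $[n]$ and $[n]^{(\ge r)}$ the set of subsets of size at least $r$. A family $\mathcal{F}$ of sets is intersecting if $F\cap F'\neq\emptyset$ for all $F,F'\in\mathcal{F}$. *)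

theory Defs
  imports Complex_Main
begin

definition layer :: "nat \<Rightarrow> nat \<Rightarrow> nat set set" where
  "layer n r = {X. X \<subseteq> {1..n} \<and> card X = r}"

definition upper_layers :: "nat \<Rightarrow> nat \<Rightarrow> nat set set" where
  "upper_layers n r = {X. X \<subseteq> {1..n} \<and> r \<le> card X}"

text \<open>The two members may coincide, so an intersecting family does not contain the empty set.\<close>

definition intersecting :: "'a set set \<Rightarrow> bool" where
  "intersecting \<F> \<longleftrightarrow> (\<forall>F\<in>\<F>. \<forall>F'\<in>\<F>. F \<inter> F' \<noteq> {})"

definition num_intersecting_subfamilies :: "nat \<Rightarrow> 'a set set \<Rightarrow> nat" where
  "num_intersecting_subfamilies s \<A> = card {\<F>. \<F> \<subseteq> \<A> \<and> card \<F> = s \<and> intersecting \<F>}"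

definition num_intersecting_pairs :: "'a set set \<Rightarrow> nat" where
  "num_intersecting_pairs \<B> =
     card {{B, B'} | B B'. B \<in> \<B> \<and> B' \<in> \<B> \<and> B \<noteq> B' \<and> B \<inter> B' \<noteq> {}}"

end

theory Submission
  imports Defs
begin

text \<open>
  Classify the intersecting subfamilies of size \<open>s\<close> by the set \<open>S\<close> of 2-element sets they contain. By symmetry
  those with at most one such set contribute an amount depending only on \<open>i\<close>, and those with exactly two
  contribute the number of intersecting pairs times a constant \<open>\<kappa>\<close>. So it suffices that the families with
  three or more 2-sets altogether number less than \<open>\<kappa>\<close>. Each of these contains a star \<open>va, vb, vc\<close> or a
  triangle; there are at most \<open>n(n-1)(n-2)\<^sup>2/6\<close> such triples, and triangles are no more frequent than stars.
  So the families through a fixed star must be outnumbered, by more than this factor, by those with exactly the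
  2-sets \<open>va, vb\<close>.

  To see this, trade \<open>vc\<close> for its complement and then admit one by one the sets \<open>co X\<close>, the complements of
  \<open>vcX\<close>, which were excluded by \<open>vc\<close>. Admitting \<open>co X\<close> multiplies the number of families by \<open>1 + \<rho>\<theta>\<close>, where \<open>\<rho>\<close> is
  the density of the families and \<open>\<theta>\<close> is the proportion surviving the deletion of the sets disjoint from \<open>co X\<close>.
  Sets are deleted at a bounded cost either against the \<open>3 \<cdot> 2\<^bsup>n-3\<^esup> - 2\<close> sets through \<open>v\<close> and one of \<open>a, b\<close>, which
  meet everything, or, when nothing smaller is left, against their own complement. For sparse families (small
  \<open>\<delta>\<close>) large \<open>X\<close> are used and the deletions are paid for each \<open>X\<close> separately; for dense ones all \<open>vY\<close> with \<open>|Y| < r\<close>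
  are deleted once and for all and \<open>X\<close> ranges over the \<open>r\<close>-sets.
\<close>

section \<open>Counting intersecting subfamilies under deletions and insertions\<close>

abbreviation (input) nisf :: "nat \<Rightarrow> 'a set set \<Rightarrow> nat" where
  "nisf \<equiv> num_intersecting_subfamilies"

definition int_families :: "nat \<Rightarrow> 'a set set \<Rightarrow> 'a set set set" where
  "int_families s \<A> = {\<F>. \<F> \<subseteq> \<A> \<and> card \<F> = s \<and> intersecting \<F>}"

lemma nisf_card: "nisf s \<A> = card (int_families s \<A>)"
  by (simp add: num_intersecting_subfamilies_def int_families_def)

lemma finite_int_families: "finite \<A> \<Longrightarrow> finite (int_families s \<A>)"
  by (rule finite_subset[of _ "Pow \<A>"]) (auto simp: int_families_def)

lemma intersecting_insert:
  "intersecting (insert Z \<F>) \<longleftrightarrow> intersecting \<F> \<and> Z \<noteq> {} \<and> (\<forall>F\<in>\<F>. F \<inter> Z \<noteq> {})"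
  by (auto simp: intersecting_def Int_commute)

lemma intersecting_subset: "intersecting \<F> \<Longrightarrow> \<G> \<subseteq> \<F> \<Longrightarrow> intersecting \<G>"
  by (auto simp: intersecting_def)

lemma nisf_mono: "finite \<B> \<Longrightarrow> \<A> \<subseteq> \<B> \<Longrightarrow> nisf s \<A> \<le> nisf s \<B>"
  unfolding nisf_card by (intro card_mono finite_int_families) (auto simp: int_families_def)

text \<open>Split by membership of \<open>Z\<close>: removing \<open>Z\<close> from a family through
  it leaves \<open>j\<close> sets of \<open>\<A>\<close>, all of which meet
  \<open>Z\<close>.\<close>

lemma nisf_insert:
  assumes "finite \<A>" "Z \<notin> \<A>" "Z \<noteq> {}"
  shows "nisf (Suc j) (insert Z \<A>) = nisf (Suc j) \<A> + nisf j {A \<in> \<A>. A \<inter> Z \<noteq> {}}"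
proof -
  let ?L = "{A \<in> \<A>. A \<inter> Z \<noteq> {}}"
  have split: "int_families (Suc j) (insert Z \<A>)
      = int_families (Suc j) \<A> \<union> insert Z ` int_families j ?L" (is "?l = ?r")
  proof
    show "?l \<subseteq> ?r"
    proof
      fix \<F> assume F: "\<F> \<in> ?l"
      show "\<F> \<in> ?r"
      proof (cases "Z \<in> \<F>")
        case True
        have fin: "finite \<F>" using F assms(1) unfolding int_families_def
          by (auto intro: finite_subset[of _ "insert Z \<A>"])
        have "\<F> - {Z} \<in> int_families j ?L"
          using F True fin assms unfolding int_families_def intersecting_def by auto
        moreover have "\<F> = insert Z (\<F> - {Z})" using True by auto
        ultimately show ?thesis by blast
      qed (use F in \<open>auto simp: int_families_def\<close>)
    qed
    show "?r \<subseteq> ?l"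
    proof
      fix \<F> assume "\<F> \<in> ?r"
      then consider "\<F> \<in> int_families (Suc j) \<A>" | \<G> where "\<G> \<in> int_families j ?L" "\<F> = insert Z \<G>" by auto
      then show "\<F> \<in> ?l"
      proof cases
        case 2
        then have "\<G> \<subseteq> ?L" "card \<G> = j" "intersecting \<G>" by (auto simp: int_families_def)
        moreover from this have "finite \<G>" "Z \<notin> \<G>" using assms by (auto intro: finite_subset[of _ \<A>])
        ultimately show ?thesis using 2(2) assms by (auto simp: int_families_def intersecting_insert)
      qed (auto simp: int_families_def)
    qed
  qed
  have inj: "inj_on (insert Z) (int_families j ?L)"
  proof (rule inj_onI)
    fix x y assume "x \<in> int_families j ?L" "y \<in> int_families j ?L" "insert Z x = insert Z y"
    moreover from this have "Z \<notin> x" "Z \<notin> y" using assms(2) by (auto simp: int_families_def)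
    ultimately show "x = y" by (metis insert_ident)
  qed
  have disj: "int_families (Suc j) \<A> \<inter> insert Z ` int_families j ?L = {}"
    using assms(2) by (auto simp: int_families_def)
  show ?thesis unfolding nisf_card split
    using assms(1) by (subst card_Un_disjoint) (auto simp: finite_int_families disj card_image inj)
qed

lemma nisf_insert_all:
  assumes "finite \<A>" "Z \<notin> \<A>" "Z \<noteq> {}" "\<And>A. A \<in> \<A> \<Longrightarrow> A \<inter> Z \<noteq> {}"
  shows "nisf (Suc j) (insert Z \<A>) = nisf (Suc j) \<A> + nisf j \<A>"
proof -
  have "{A \<in> \<A>. A \<inter> Z \<noteq> {}} = \<A>" using assms(4) by auto
  with nisf_insert[OF assms(1-3)] show ?thesis by simp
qed

section \<open>Double counting with one set added or removed\<close>

text \<open>Count pairs of a family of size \<open>Suc j\<close> and one of its members. Taking the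
  member out is injective on such pairs, and a family of size \<open>j\<close> leaves
  \<open>card \<A> - j\<close> sets to put back.\<close>

lemma nisf_Suc_le:
  assumes fin: "finite \<A>"
  shows "Suc j * nisf (Suc j) \<A> \<le> (card \<A> - j) * nisf j \<A>"
proof -
  let ?L = "SIGMA \<F>:int_families (Suc j) \<A>. \<F>" and ?R = "SIGMA \<F>:int_families j \<A>. \<A> - \<F>"
  have fs: "finite \<F>" if "\<F> \<in> int_families k \<A>" for \<F> k
    using that fin by (auto simp: int_families_def intro: finite_subset)
  have "card ?L = (\<Sum>\<F>\<in>int_families (Suc j) \<A>. card \<F>)"
    using fin fs by (intro card_SigmaI) (auto simp: finite_int_families)
  also have "\<dots> = (\<Sum>\<F>\<in>int_families (Suc j) \<A>. Suc j)"
    by (intro sum.cong) (auto simp: int_families_def)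
  finally have L: "card ?L = Suc j * nisf (Suc j) \<A>" by (simp add: nisf_card)
  have "card ?R = (\<Sum>\<F>\<in>int_families j \<A>. card (\<A> - \<F>))"
    using fin fs by (intro card_SigmaI) (auto simp: finite_int_families)
  also have "\<dots> = (\<Sum>\<F>\<in>int_families j \<A>. card \<A> - j)"
    using fs by (intro sum.cong) (auto simp: int_families_def card_Diff_subset)
  finally have R: "card ?R = (card \<A> - j) * nisf j \<A>" by (simp add: nisf_card)
  have "card ?L \<le> card ?R"
  proof (rule card_inj_on_le[of "\<lambda>(\<F>, x). (\<F> - {x}, x)"])
    show "inj_on (\<lambda>(\<F>, x). (\<F> - {x}, x)) ?L" by (auto simp: inj_on_def)
    show "(\<lambda>(\<F>, x). (\<F> - {x}, x)) ` ?L \<subseteq> ?R"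
      using fs by (auto simp: int_families_def card_Diff_singleton intro: intersecting_subset)
    show "finite ?R" using fin by (auto simp: finite_int_families intro!: finite_SigmaI)
  qed
  then show ?thesis by (simp only: L R)
qed

text \<open>The converse count. A set of the bath \<open>\<G>\<close> meets every set of
  \<open>\<A>\<close>, itself included, so it can join any family not yet containing it. A family of
  size \<open>j\<close> offers at least \<open>card \<G> - j\<close> such choices, and one of size
  \<open>Suc j\<close> is reached at most \<open>Suc j\<close> times.\<close>

lemma nisf_bath_up:
  assumes fin: "finite \<A>" and sub: "\<G> \<subseteq> \<A>"
    and meets: "\<And>g A. g \<in> \<G> \<Longrightarrow> A \<in> \<A> \<Longrightarrow> g \<inter> A \<noteq> {}"
  shows "(card \<G> - j) * nisf j \<A> \<le> Suc j * nisf (Suc j) \<A>"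
proof -
  let ?L = "SIGMA \<F>:int_families j \<A>. \<G> - \<F>" and ?R = "SIGMA \<F>:int_families (Suc j) \<A>. \<F>"
  have fs: "finite \<F>" if "\<F> \<in> int_families k \<A>" for \<F> k
    using that fin by (auto simp: int_families_def intro: finite_subset)
  have finG: "finite \<G>" using fin sub finite_subset by auto
  have "card ?R = (\<Sum>\<F>\<in>int_families (Suc j) \<A>. card \<F>)"
    using fin fs by (intro card_SigmaI) (auto simp: finite_int_families)
  also have "\<dots> = (\<Sum>\<F>\<in>int_families (Suc j) \<A>. Suc j)"
    by (intro sum.cong) (auto simp: int_families_def)
  finally have R: "card ?R = Suc j * nisf (Suc j) \<A>" by (simp add: nisf_card)
  have "(card \<G> - j) * nisf j \<A> = (\<Sum>\<F>\<in>int_families j \<A>. card \<G> - j)"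
    by (simp add: nisf_card)
  also have "\<dots> \<le> (\<Sum>\<F>\<in>int_families j \<A>. card (\<G> - \<F>))"
  proof (rule sum_mono)
    fix \<F> assume F: "\<F> \<in> int_families j \<A>"
    then have "card \<F> = j" by (simp add: int_families_def)
    then show "card \<G> - j \<le> card (\<G> - \<F>)" using diff_card_le_card_Diff[OF fs[OF F], of \<G>] by simp
  qed
  also have "\<dots> = card ?L"
    using fin finG by (intro card_SigmaI[symmetric]) (auto simp: finite_int_families)
  also have "\<dots> \<le> card ?R"
  proof (rule card_inj_on_le[of "\<lambda>(\<F>, x). (insert x \<F>, x)"])
    show "inj_on (\<lambda>(\<F>, x). (insert x \<F>, x)) ?L" by (auto simp: inj_on_def dest: insert_ident)
    show "(\<lambda>(\<F>, x). (insert x \<F>, x)) ` ?L \<subseteq> ?R"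
    proof clarify
      fix \<F> x assume F: "\<F> \<in> int_families j \<A>" and x: "x \<in> \<G>" "x \<notin> \<F>"
      have "insert x \<F> \<in> int_families (Suc j) \<A>"
        using F x fs[OF F] sub meets[OF x(1)] unfolding int_families_def
        by (fastforce simp: intersecting_insert Int_commute)
      then show "insert x \<F> \<in> int_families (Suc j) \<A> \<and> x \<in> insert x \<F>" by simp
    qed
    show "finite ?R" using fin fs by (auto simp: finite_int_families intro!: finite_SigmaI)
  qed
  finally show ?thesis using R by simp
qed

lemma nisf_bath_start:
  fixes \<A> :: "'a set set"
  assumes fin: "finite \<A>" and sub: "\<G> \<subseteq> \<A>"
    and meets: "\<And>g A. g \<in> \<G> \<Longrightarrow> A \<in> \<A> \<Longrightarrow> g \<inter> A \<noteq> {}"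
    and Z: "Z \<notin> \<A>" "Z \<noteq> {}" "\<And>A. A \<in> \<A> \<Longrightarrow> A \<inter> Z \<noteq> {}"
  shows "real (card \<G> + 1) * nisf j \<A> \<le> real (Suc j) * nisf (Suc j) (insert Z \<A>)"
    and "nisf j \<A> \<le> nisf (Suc j) (insert Z \<A>)"
proof -
  have eq: "nisf (Suc j) (insert Z \<A>) = nisf (Suc j) \<A> + nisf j \<A>"
    by (rule nisf_insert_all[OF fin Z])
  then show "nisf j \<A> \<le> nisf (Suc j) (insert Z \<A>)" by simp
  \<comment> \<open>The families through \<open>Z\<close> supply the weight \<open>Suc j\<close>.
    Equality can fail because the difference is cut off at 0 when \<open>j\<close> exceeds
    \<open>card \<G>\<close>.\<close>
  have "card \<G> + 1 \<le> (card \<G> - j) + Suc j" by simp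
  then have "(card \<G> + 1) * nisf j \<A> \<le> (card \<G> - j) * nisf j \<A> + Suc j * nisf j \<A>"
    by (metis add_mult_distrib mult_le_mono1)
  also have "\<dots> \<le> Suc j * nisf (Suc j) (insert Z \<A>)"
    using nisf_bath_up[OF fin sub meets, of j] unfolding eq by (simp add: algebra_simps)
  finally show "real (card \<G> + 1) * nisf j \<A> \<le> real (Suc j) * nisf (Suc j) (insert Z \<A>)"
    by (simp only: of_nat_mult[symmetric] of_nat_le_iff)
qed

section \<open>Deleting, trading and inserting a single set\<close>

text \<open>Let \<open>b\<close> families avoid \<open>Z\<close> and \<open>l\<close> contain it.
  Strip \<open>Z\<close> from the latter and add a bath set instead: this gives
  \<open>(card \<G> - j) * l \<le> Suc j * b\<close>, so the share of families lost is at most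
  \<open>Suc j / (card \<G> + 1)\<close>.\<close>

lemma nisf_delete:
  fixes \<A> :: "'a set set" and \<delta> :: real
  assumes fin: "finite \<A>" and sub: "\<G> \<subseteq> \<A>"
    and meets: "\<And>g A. g \<in> \<G> \<Longrightarrow> A \<in> \<A> \<Longrightarrow> g \<inter> A \<noteq> {}"
    and Z: "Z \<notin> \<G>" "Z \<noteq> {}"
    and \<delta>: "real (Suc j) \<le> \<delta> * real (card \<G> + 1)" "\<delta> \<le> 1"
  shows "(1 - \<delta>) * nisf (Suc j) \<A> \<le> nisf (Suc j) (\<A> - {Z})"
proof (cases "Z \<in> \<A>")
  case False
  have "0 \<le> \<delta> * real (card \<G> + 1)" using \<delta> by linarith
  then have "0 \<le> \<delta>" by (simp add: zero_le_mult_iff)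
  then show ?thesis using False by (simp add: mult_left_le_one_le algebra_simps)
next
  case True
  let ?L = "{A \<in> \<A> - {Z}. A \<inter> Z \<noteq> {}}"
  have eq: "nisf (Suc j) \<A> = nisf (Suc j) (\<A> - {Z}) + nisf j ?L"
    using nisf_insert[of "\<A> - {Z}" Z j] fin Z(2) True by (simp add: insert_absorb)
  have "\<G> \<subseteq> ?L" using sub Z(1) meets[OF _ True] by auto
  then have "(card \<G> - j) * nisf j ?L \<le> Suc j * nisf (Suc j) ?L"
    using fin meets by (intro nisf_bath_up) auto
  also have "\<dots> \<le> Suc j * nisf (Suc j) (\<A> - {Z})"
    using fin by (intro mult_left_mono nisf_mono) auto
  finally have *: "(card \<G> - j) * nisf j ?L \<le> Suc j * nisf (Suc j) (\<A> - {Z})" .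
  define b l where "b = real (nisf (Suc j) (\<A> - {Z}))" and "l = real (nisf j ?L)"
  have "\<delta> * real (card \<G> + 1) \<le> 1 * real (card \<G> + 1)"
    by (rule mult_right_mono[OF \<delta>(2)]) simp
  with \<delta>(1) have "real (Suc j) \<le> 1 * real (card \<G> + 1)" by (rule order_trans)
  \<comment> \<open>As \<delta> is at most 1, \<open>j\<close> is at most \<open>card \<G>\<close>,
    and the truncated difference agrees with the real one.\<close>
  then have jw: "Suc j \<le> card \<G> + 1" by (simp del: of_nat_Suc of_nat_add)
  have "real ((card \<G> - j) * nisf j ?L) \<le> real (Suc j * nisf (Suc j) (\<A> - {Z}))"
    using * by (simp only: of_nat_le_iff)
  then have 1: "(real (card \<G> + 1) - real (Suc j)) * l \<le> real (Suc j) * b"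
    using jw by (simp add: b_def l_def of_nat_diff distrib_right)
  have "(1 - \<delta>) * real (card \<G> + 1) * l \<le> (real (card \<G> + 1) - real (Suc j)) * l"
    using \<delta>(1) by (intro mult_right_mono) (auto simp: l_def algebra_simps)
  also note 1
  also have "real (Suc j) * b \<le> \<delta> * real (card \<G> + 1) * b"
    using \<delta>(1) by (intro mult_right_mono) (auto simp: b_def)
  finally have "real (card \<G> + 1) * ((1 - \<delta>) * l) \<le> real (card \<G> + 1) * (\<delta> * b)"
    by (simp add: algebra_simps)
  then have "(1 - \<delta>) * l \<le> \<delta> * b" by (subst (asm) mult_le_cancel_left_pos) auto
  then show ?thesis unfolding eq of_nat_add b_def[symmetric] l_def[symmetric]
    by (simp add: algebra_simps)
qed

lemma nisf_delete_set:
  fixes \<A> :: "'a set set" and \<delta> :: real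
  assumes fin: "finite \<A>" and sub: "\<G> \<subseteq> \<A>"
    and meets: "\<And>g A. g \<in> \<G> \<Longrightarrow> A \<in> \<A> \<Longrightarrow> g \<inter> A \<noteq> {}"
    and D: "finite \<D>" "\<D> \<inter> \<G> = {}" "{} \<notin> \<D>"
    and \<delta>: "real (Suc j) \<le> \<delta> * real (card \<G> + 1)" "\<delta> \<le> 1"
  shows "(1 - \<delta>) ^ card \<D> * nisf (Suc j) \<A> \<le> nisf (Suc j) (\<A> - \<D>)"
  using D
proof (induction \<D> rule: finite_induct)
  case (insert Z \<D>)
  have "(1 - \<delta>) ^ card (insert Z \<D>) * nisf (Suc j) \<A> = (1 - \<delta>) * ((1 - \<delta>) ^ card \<D> * nisf (Suc j) \<A>)"
    using insert.hyps by simp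
  also have "\<dots> \<le> (1 - \<delta>) * nisf (Suc j) (\<A> - \<D>)"
    using insert \<delta>(2) by (intro mult_left_mono) auto
  also have "\<dots> \<le> nisf (Suc j) (\<A> - \<D> - {Z})"
    using insert.prems fin sub by (intro nisf_delete[OF _ _ meets _ _ \<delta>]) auto
  also have "\<A> - \<D> - {Z} = \<A> - insert Z \<D>" by auto
  finally show ?case .
qed simp

text \<open>The families through \<open>Z\<close> inject into those through \<open>Z'\<close>, and a second time, weighted, into those
  avoiding both; the latter uses the sets of \<open>\<G>\<close>, which meet everything.\<close>

lemma nisf_delete_complement:
  fixes \<A> :: "'a set set" and \<delta> :: real
  assumes fin: "finite \<A>" and sub: "\<G> \<subseteq> \<A>"
    and meets: "\<And>g A. g \<in> \<G> \<Longrightarrow> A \<in> \<A> \<Longrightarrow> g \<inter> A \<noteq> {}"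
    and Z: "Z \<in> \<A>" "Z \<notin> \<G>" "Z \<noteq> {}"
    and Z': "Z' \<in> \<A>" "Z' \<noteq> {}" "Z \<inter> Z' = {}" "\<And>A. A \<in> \<A> - {Z} \<Longrightarrow> A \<inter> Z' \<noteq> {}"
    and \<delta>: "real (Suc j) \<le> \<delta> * real (card \<G> + 1)"
  shows "nisf (Suc j) \<A> \<le> (1 + min \<delta> 1) * nisf (Suc j) (\<A> - {Z})"
proof -
  let ?L = "{A \<in> \<A> - {Z}. A \<inter> Z \<noteq> {}}"
  have eq: "nisf (Suc j) \<A> = nisf (Suc j) (\<A> - {Z}) + nisf j ?L"
    using nisf_insert[of "\<A> - {Z}" Z j] fin Z by (simp add: insert_absorb)
  have "\<G> \<subseteq> ?L" using sub Z(2) meets[OF _ Z(1)] by auto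
  then have *: "(card \<G> - j) * nisf j ?L \<le> Suc j * nisf (Suc j) ?L"
    using fin meets by (intro nisf_bath_up) auto
  have "nisf (Suc j) ?L + nisf j ?L = nisf (Suc j) (insert Z' ?L)"
    using fin Z' by (intro nisf_insert_all[symmetric]) (auto simp: Int_commute)
  also have "\<dots> \<le> nisf (Suc j) (\<A> - {Z})"
    using fin Z' Z(3) by (intro nisf_mono) auto
  finally have **: "nisf (Suc j) ?L + nisf j ?L \<le> nisf (Suc j) (\<A> - {Z})" .
  define b l where "b = real (nisf (Suc j) (\<A> - {Z}))" and "l = real (nisf j ?L)"
  have "(card \<G> + 1) * nisf j ?L \<le> ((card \<G> - j) + Suc j) * nisf j ?L"
    by (intro mult_right_mono) auto
  also have "\<dots> = (card \<G> - j) * nisf j ?L + Suc j * nisf j ?L" by (rule add_mult_distrib)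
  also have "\<dots> \<le> Suc j * (nisf (Suc j) ?L + nisf j ?L)" using * by (simp add: algebra_simps)
  also have "\<dots> \<le> Suc j * nisf (Suc j) (\<A> - {Z})" using ** by (rule mult_left_mono) simp
  finally have "real ((card \<G> + 1) * nisf j ?L) \<le> real (Suc j * nisf (Suc j) (\<A> - {Z}))"
    by (simp only: of_nat_le_iff)
  then have "real (card \<G> + 1) * l \<le> real (Suc j) * b"
    by (simp only: l_def b_def of_nat_mult)
  also have "\<dots> \<le> \<delta> * real (card \<G> + 1) * b" by (rule mult_right_mono[OF \<delta>]) (simp add: b_def)
  finally have "real (card \<G> + 1) * l \<le> real (card \<G> + 1) * (\<delta> * b)" by (simp add: algebra_simps)
  then have 1: "l \<le> \<delta> * b" by (subst (asm) mult_le_cancel_left_pos) auto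
  \<comment> \<open>The injection through \<open>Z'\<close> alone works at every density; it is the
    source of the cap 1 in \<open>min \<delta> 1\<close>.\<close>
  have "l \<le> b" using ** by (simp add: b_def l_def)
  with 1 have "l \<le> min \<delta> 1 * b" by (auto simp: min_def)
  then show ?thesis unfolding eq of_nat_add b_def[symmetric] l_def[symmetric]
    by (simp add: algebra_simps)
qed

text \<open>Replace \<open>Z\<close> by \<open>Z'\<close> in the families through \<open>Z\<close>;
  nothing obstructs this, since \<open>Z'\<close> meets all the remaining sets.\<close>

lemma nisf_switch:
  assumes "finite \<A>" "Z \<in> \<A>" "Z' \<notin> \<A>" "Z \<noteq> {}" "Z' \<noteq> {}" "\<And>A. A \<in> \<A> - {Z} \<Longrightarrow> A \<inter> Z' \<noteq> {}"
  shows "nisf (Suc j) \<A> \<le> nisf (Suc j) (insert Z' (\<A> - {Z}))"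
proof -
  have "nisf (Suc j) \<A> = nisf (Suc j) (\<A> - {Z}) + nisf j {A \<in> \<A> - {Z}. A \<inter> Z \<noteq> {}}"
    using nisf_insert[of "\<A> - {Z}" Z j] assms by (simp add: insert_absorb)
  also have "\<dots> \<le> nisf (Suc j) (\<A> - {Z}) + nisf j (\<A> - {Z})"
    using assms by (intro add_left_mono nisf_mono) auto
  also have "\<dots> = nisf (Suc j) (insert Z' (\<A> - {Z}))"
    using assms by (intro nisf_insert_all[symmetric]) auto
  finally show ?thesis .
qed

text \<open>Families avoiding \<open>Z\<close> are handled by \<open>nisf_Suc_le\<close> in
  \<open>\<A> - {Z}\<close>; those through \<open>Z\<close> lose \<open>Z\<close> and become
  families of size \<open>j\<close>. The weights \<open>card \<A> - 1 - j\<close> and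
  \<open>Suc j\<close> add up to \<open>card \<A>\<close>.\<close>

lemma nisf_remove_one_smaller:
  assumes fin: "finite \<A>" and Z: "Z \<in> \<A>" "Z \<noteq> {}"
  shows "Suc j * nisf (Suc j) \<A> \<le> card \<A> * nisf j (\<A> - {Z})"
proof -
  have "nisf (Suc j) \<A> = nisf (Suc j) (\<A> - {Z}) + nisf j {A \<in> \<A> - {Z}. A \<inter> Z \<noteq> {}}"
    using nisf_insert[of "\<A> - {Z}" Z j] assms by (simp add: insert_absorb)
  also have "\<dots> \<le> nisf (Suc j) (\<A> - {Z}) + nisf j (\<A> - {Z})"
    using assms by (intro add_left_mono nisf_mono) auto
  finally have "Suc j * nisf (Suc j) \<A> \<le> Suc j * nisf (Suc j) (\<A> - {Z}) + Suc j * nisf j (\<A> - {Z})"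
    by (metis add_mult_distrib2 mult_le_mono2)
  also have "\<dots> \<le> (card (\<A> - {Z}) - j) * nisf j (\<A> - {Z}) + Suc j * nisf j (\<A> - {Z})"
    using fin by (intro add_right_mono nisf_Suc_le) auto
  also have "\<dots> = ((card (\<A> - {Z}) - j) + Suc j) * nisf j (\<A> - {Z})" by (simp only: add_mult_distrib)
  also have "\<dots> \<le> card \<A> * nisf j (\<A> - {Z})"
  proof (cases "j \<le> card (\<A> - {Z})")
    case True
    have "Suc (card (\<A> - {Z})) = card \<A>" using card_Suc_Diff1[OF fin Z(1)] .
    then have "(card (\<A> - {Z}) - j) + Suc j = card \<A>" using True by simp
    then show ?thesis by simp
  next
    \<comment> \<open>Here truncation spoils the sum of the weights, but no family of size
      \<open>j\<close> fits into \<open>\<A> - {Z}\<close>, so both sides vanish.\<close>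
    case False
    have "int_families j (\<A> - {Z}) = {}"
    proof (rule ccontr)
      assume "int_families j (\<A> - {Z}) \<noteq> {}"
      then obtain \<F> where "\<F> \<subseteq> \<A> - {Z}" "card \<F> = j" by (auto simp: int_families_def)
      then show False using False card_mono[of "\<A> - {Z}" \<F>] fin by auto
    qed
    then show ?thesis by (simp add: nisf_card)
  qed
  finally show ?thesis .
qed

text \<open>The set \<open>Z\<close> is treated separately because it need not be traded for anything: a family through \<open>Z\<close>
  turns into one through \<open>W\<close> without changing its size.\<close>

lemma nisf_add:
  fixes \<A> :: "'a set set" and \<rho> \<theta> :: real
  assumes fin: "finite \<A>" and W: "W \<notin> \<A>" "W \<noteq> {}"
    and D: "{A \<in> \<A>. A \<inter> W = {}} = insert Z \<D>" "Z \<notin> \<D>" "Z \<noteq> {}"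
    and \<rho>: "\<rho> * real (card \<A>) \<le> real (Suc j)" "0 \<le> \<rho>"
    and \<theta>: "\<theta> * nisf (Suc j) \<A> \<le> nisf (Suc j) (\<A> - \<D>)"
  shows "(1 + \<rho> * \<theta>) * nisf (Suc j) \<A> \<le> nisf (Suc j) (insert W \<A>)"
proof -
  have ZD: "Z \<in> \<A>" "\<D> \<subseteq> \<A>" using D by auto
  have eq: "{A \<in> \<A>. A \<inter> W \<noteq> {}} = \<A> - \<D> - {Z}" using D(1) ZD by blast
  have *: "Suc j * nisf (Suc j) (\<A> - \<D>) \<le> card (\<A> - \<D>) * nisf j (\<A> - \<D> - {Z})"
    using fin D ZD by (intro nisf_remove_one_smaller) auto
  have c: "card (\<A> - \<D>) \<le> card \<A>" using fin by (intro card_mono) auto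
  have pos: "real (card \<A>) > 0" using fin ZD by (auto simp: card_gt_0_iff)
  have "\<rho> * real (card \<A>) * nisf (Suc j) (\<A> - \<D>) \<le> real (Suc j) * nisf (Suc j) (\<A> - \<D>)"
    by (rule mult_right_mono[OF \<rho>(1)]) simp
  also have "\<dots> \<le> real (card \<A>) * nisf j (\<A> - \<D> - {Z})"
    using le_trans[OF * mult_le_mono1[OF c]] by (simp only: of_nat_mult[symmetric] of_nat_le_iff)
  finally have "real (card \<A>) * (\<rho> * nisf (Suc j) (\<A> - \<D>)) \<le> real (card \<A>) * nisf j (\<A> - \<D> - {Z})"
    by (simp add: algebra_simps)
  then have 1: "\<rho> * nisf (Suc j) (\<A> - \<D>) \<le> nisf j (\<A> - \<D> - {Z})"
    using pos by (subst (asm) mult_le_cancel_left_pos) auto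
  have "\<rho> * (\<theta> * nisf (Suc j) \<A>) \<le> \<rho> * nisf (Suc j) (\<A> - \<D>)"
    by (rule mult_left_mono[OF \<theta> \<rho>(2)])
  with 1 have "\<rho> * (\<theta> * nisf (Suc j) \<A>) \<le> nisf j (\<A> - \<D> - {Z})" by linarith
  then show ?thesis using nisf_insert[OF fin W, of j] by (simp add: eq algebra_simps)
qed

section \<open>From a star to a pair\<close>

lemma card_subsets_trace:
  assumes "finite S" "K \<subseteq> S" "\<P> \<subseteq> Pow K"
  shows "card {Z. Z \<subseteq> S \<and> Z \<inter> K \<in> \<P>} = card \<P> * 2 ^ (card S - card K)"
proof -
  have "bij_betw (\<lambda>(A, X). A \<union> X) (\<P> \<times> Pow (S - K)) {Z. Z \<subseteq> S \<and> Z \<inter> K \<in> \<P>}"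
  proof (rule bij_betw_byWitness[where f' = "\<lambda>Z. (Z \<inter> K, Z - K)"])
    show "\<forall>x\<in>\<P> \<times> Pow (S - K). (\<lambda>Z. (Z \<inter> K, Z - K)) ((\<lambda>(A, X). A \<union> X) x) = x"
      using assms by auto
    show "(\<lambda>(A, X). A \<union> X) ` (\<P> \<times> Pow (S - K)) \<subseteq> {Z. Z \<subseteq> S \<and> Z \<inter> K \<in> \<P>}"
    proof clarify
      fix A X assume "A \<in> \<P>" "X \<subseteq> S - K"
      moreover from this have "(A \<union> X) \<inter> K = A" using assms by auto
      ultimately show "A \<union> X \<subseteq> S \<and> (A \<union> X) \<inter> K \<in> \<P>" using assms by auto
    qed
  qed auto
  then have "card {Z. Z \<subseteq> S \<and> Z \<inter> K \<in> \<P>} = card (\<P> \<times> Pow (S - K))"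
    by (simp add: bij_betw_same_card)
  also have "\<dots> = card \<P> * 2 ^ (card S - card K)"
    using assms by (simp add: card_cartesian_product card_Pow card_Diff_subset finite_subset)
  finally show ?thesis .
qed

section \<open>A star of three 2-sets, its compatible sets and the intermediate stages\<close>

locale star_config =
  fixes n v a b c :: nat
  assumes n: "21 \<le> n"
    and in_ground: "v \<in> {1..n}" "a \<in> {1..n}" "b \<in> {1..n}" "c \<in> {1..n}"
    and distinct: "v \<noteq> a" "v \<noteq> b" "v \<noteq> c" "a \<noteq> b" "a \<noteq> c" "b \<noteq> c"
begin

definition rest :: "nat set" where "rest = {1..n} - {v, a, b, c}"

definition star_compatible :: "nat set set" where
  "star_compatible = {Z. Z \<subseteq> {1..n} \<and> 2 \<le> card Z \<and> Z \<notin> {{v, a}, {v, b}, {v, c}} \<and> (v \<in> Z \<or> {a, b, c} \<subseteq> Z)}"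

text \<open>Size 2 is excluded, as these sets accompany \<open>{v, a}\<close> and
  \<open>{v, b}\<close> in families with no other 2-set.\<close>

definition pair_compatible :: "nat set set" where
  "pair_compatible = {Z. Z \<subseteq> {1..n} \<and> 3 \<le> card Z \<and> (v \<in> Z \<or> {a, b} \<subseteq> Z)}"

text \<open>A reservoir meeting every set that contains \<open>v\<close> or both \<open>a\<close>
  and \<open>b\<close>, hence every member of every stage.\<close>

definition bath :: "nat set set" where
  "bath = {Z. Z \<subseteq> {1..n} \<and> 3 \<le> card Z \<and> v \<in> Z \<and> (a \<in> Z \<or> b \<in> Z)}"

definition co :: "nat set \<Rightarrow> nat set" where
  "co X = {1..n} - insert v (insert c X)"

text \<open>For \<open>X\<close> in \<open>P\<close> the sets \<open>insert v X\<close> and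
  \<open>insert v (insert c X)\<close> are gone and \<open>co X\<close> has come in; for
  \<open>X\<close> in \<open>Q\<close> only the latter has happened. The complement
  \<open>co {}\<close> of \<open>{v, c}\<close> is present from the start.\<close>

definition stage :: "nat set set \<Rightarrow> nat set set \<Rightarrow> nat set set" where
  "stage P Q = (insert (co {}) star_compatible - (insert v ` P \<union> (\<lambda>X. insert v (insert c X)) ` P)) \<union> co ` (P \<union> Q)"

lemma card_rest: "card rest = n - 4" and finite_rest: "finite rest"
proof -
  have "card {v, a, b, c} = 4" using distinct by simp
  moreover have "{v, a, b, c} \<subseteq> {1..n}" using in_ground by auto
  ultimately show "card rest = n - 4" unfolding rest_def by (simp add: card_Diff_subset)
qed (simp add: rest_def)

text \<open>Three traces on \<open>{v, a, b}\<close> give \<open>3 * 2 ^ (n - 3)\<close> sets, of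
  which only \<open>{v, a}\<close> and \<open>{v, b}\<close> are too small.\<close>

lemma card_bath: "card bath + 1 = 3 * 2 ^ (n - 3) - 1"
proof -
  let ?K = "{v, a, b}"
  have K: "card ?K = 3" "?K \<subseteq> {1..n}" using in_ground distinct by auto
  let ?T = "{Z. Z \<subseteq> {1..n} \<and> Z \<inter> ?K \<in> {{v, a}, {v, b}, {v, a, b}}}"
  have "card {{v, a}, {v, b}, {v, a, b}} = 3"
    using distinct by (auto simp: card_insert_if doubleton_eq_iff)
  then have T: "card ?T = 3 * 2 ^ (n - 3)"
    using K by (subst card_subsets_trace) auto
  have eq: "bath = ?T - {{v, a}, {v, b}}"
  proof (intro set_eqI iffI)
    fix Z assume "Z \<in> bath"
    then have Z: "Z \<subseteq> {1..n}" "3 \<le> card Z" "v \<in> Z" "a \<in> Z \<or> b \<in> Z" by (auto simp: bath_def)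
    then have "Z \<notin> {{v, a}, {v, b}}" using distinct by auto
    moreover have "Z \<inter> ?K \<in> {{v, a}, {v, b}, {v, a, b}}" using Z distinct by auto
    ultimately show "Z \<in> ?T - {{v, a}, {v, b}}" using Z by auto
  next
    fix Z assume Z: "Z \<in> ?T - {{v, a}, {v, b}}"
    then have fin: "finite Z" by (auto intro: finite_subset)
    have mem: "v \<in> Z" "a \<in> Z \<or> b \<in> Z" using Z distinct by auto
    then obtain x where x: "x \<in> {a, b}" "x \<in> Z" by auto
    with mem Z obtain y where "y \<in> Z" "y \<notin> {v, x}" by blast
    then have "card {v, x, y} \<le> card Z" "card {v, x, y} = 3"
      using fin mem x distinct by (auto intro!: card_mono)
    then show "Z \<in> bath" using Z mem by (auto simp: bath_def)
  qed
  have sub: "{{v, a}, {v, b}} \<subseteq> ?T" using in_ground distinct by auto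
  have "card {{v, a}, {v, b}} = 2" using distinct by (auto simp: doubleton_eq_iff)
  then have "card bath = 3 * 2 ^ (n - 3) - 2"
    unfolding eq using T sub by (subst card_Diff_subset) auto
  moreover have "(2::nat) ^ 1 \<le> 2 ^ (n - 3)" using n by (intro power_increasing) auto
  ultimately show ?thesis by simp
qed

lemma finite_star_compatible: "finite star_compatible"
  by (rule finite_subset[of _ "Pow {1..n}"]) (auto simp: star_compatible_def)

lemma co_mem: "X \<subseteq> rest \<Longrightarrow> a \<in> co X \<and> b \<in> co X \<and> v \<notin> co X \<and> c \<notin> co X \<and> co X \<subseteq> {1..n}"
  using in_ground distinct by (auto simp: co_def rest_def)

lemma inj_co: "inj_on co (Pow rest)"
proof (rule inj_onI)
  fix X Y assume "X \<in> Pow rest" "Y \<in> Pow rest" "co X = co Y"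
  moreover have "X = rest - co X" if "X \<subseteq> rest" for X using that by (auto simp: co_def rest_def)
  ultimately show "X = Y" by (metis PowD)
qed

section \<open>Membership in a stage\<close>

lemma stage_mem:
  assumes "P \<subseteq> Pow rest" "Q \<subseteq> Pow rest" "Z \<in> stage P Q"
  shows "Z \<subseteq> {1..n}" "v \<in> Z \<or> a \<in> Z \<and> b \<in> Z" "Z \<noteq> {v}"
proof -
  consider "Z \<in> star_compatible" | X where "X \<subseteq> rest" "Z = co X"
    using assms unfolding stage_def by blast
  then have "Z \<subseteq> {1..n} \<and> (v \<in> Z \<or> a \<in> Z \<and> b \<in> Z) \<and> Z \<noteq> {v}"
  proof cases
    case 1
    then show ?thesis by (auto simp: star_compatible_def)
  next
    case 2
    then show ?thesis using co_mem[of X] by blast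
  qed
  then show "Z \<subseteq> {1..n}" "v \<in> Z \<or> a \<in> Z \<and> b \<in> Z" "Z \<noteq> {v}" by simp_all
qed

lemma finite_stage:
  assumes "P \<subseteq> Pow rest" "Q \<subseteq> Pow rest"
  shows "finite (stage P Q)"
proof (rule finite_subset)
  show "stage P Q \<subseteq> Pow {1..n}" using stage_mem(1)[OF assms] by blast
qed simp

text \<open>Five of the eight traces on \<open>{v, a, b}\<close> can occur. Against the three traces
  of the bath this is the ratio 3/5, from which the later comparison of \<rho> with \<delta>
  comes.\<close>

lemma card_stage:
  assumes "P \<subseteq> Pow rest" "Q \<subseteq> Pow rest"
  shows "card (stage P Q) \<le> 5 * 2 ^ (n - 3)"
proof -
  let ?K = "{v, a, b}" and ?P = "{{v}, {v, a}, {v, b}, {v, a, b}, {a, b}}"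
  have K: "card ?K = 3" "?K \<subseteq> {1..n}" using in_ground distinct by auto
  have "stage P Q \<subseteq> {Z. Z \<subseteq> {1..n} \<and> Z \<inter> ?K \<in> ?P}"
    using stage_mem(1,2)[OF assms] by auto
  then have "card (stage P Q) \<le> card {Z. Z \<subseteq> {1..n} \<and> Z \<inter> ?K \<in> ?P}"
    by (intro card_mono) (auto intro: finite_subset[of _ "Pow {1..n}"])
  also have "\<dots> = card ?P * 2 ^ (n - 3)" using K by (subst card_subsets_trace) auto
  also have "\<dots> \<le> 5 * 2 ^ (n - 3)"
    using card_length[of "[{v}, {v, a}, {v, b}, {v, a, b}, {a, b}]"] by (intro mult_right_mono) simp_all
  finally show ?thesis .
qed

lemma bath_meets:
  assumes "P \<subseteq> Pow rest" "Q \<subseteq> Pow rest" "g \<in> bath" "Z \<in> stage P Q"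
  shows "g \<inter> Z \<noteq> {}"
  using assms(3) stage_mem(2)[OF assms(1,2,4)] by (auto simp: bath_def)

lemma bath_sub_star: "bath \<subseteq> star_compatible"
  using distinct by (auto simp: bath_def star_compatible_def)

lemma bath_sub:
  assumes "P \<subseteq> Pow rest"
  shows "bath \<subseteq> stage P Q"
proof
  fix Z assume Z: "Z \<in> bath"
  then have "a \<in> Z \<or> b \<in> Z" by (auto simp: bath_def)
  then have "Z \<notin> insert v ` P \<union> (\<lambda>X. insert v (insert c X)) ` P"
    using assms distinct by (auto simp: rest_def)
  then show "Z \<in> stage P Q" using Z bath_sub_star by (auto simp: stage_def)
qed

text \<open>Every \<open>co Y\<close> with \<open>Y \<subseteq> rest\<close> contains
  \<open>a\<close>, and so does every compatible set avoiding \<open>v\<close>; neither fits into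
  \<open>insert v (insert c X)\<close>. What remains are compatible sets through \<open>v\<close>
  that \<open>P\<close> has not removed, and \<open>{v}\<close> and \<open>{v, c}\<close> are not
  compatible.\<close>

lemma stage_small:
  assumes PQ: "P \<subseteq> Pow rest" "Q \<subseteq> Pow rest" and Z: "Z \<in> stage P Q"
    and X: "X \<subseteq> rest" "Z \<subseteq> insert v (insert c X)"
  obtains Y where "Y \<subseteq> X" "Y \<noteq> {}" "Y \<notin> P" "Z = insert v Y \<or> Z = insert v (insert c Y)"
proof -
  have a: "a \<notin> Z" using X distinct by (auto simp: rest_def)
  have "Z \<notin> co ` insert {} (P \<union> Q)"
  proof
    assume "Z \<in> co ` insert {} (P \<union> Q)"
    then obtain Y where "Y \<subseteq> rest" "Z = co Y" using PQ by blast
    then show False using a co_mem by blast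
  qed
  then have "Z \<in> star_compatible" "Z \<notin> insert v ` P" "Z \<notin> (\<lambda>X. insert v (insert c X)) ` P"
    using Z unfolding stage_def by auto
  moreover from this a have v: "v \<in> Z" "Z \<noteq> {v}" "Z \<noteq> {v, c}" by (auto simp: star_compatible_def)
  moreover have Y: "Z = insert v (Z - {v, c}) \<or> Z = insert v (insert c (Z - {v, c}))" using v by auto
  moreover have "Z - {v, c} \<noteq> {}" using v by auto
  moreover have "Z - {v, c} \<subseteq> X" using X by auto
  ultimately show ?thesis using that[of "Z - {v, c}"] by blast
qed

lemma left_in_stage:
  assumes "P \<subseteq> Pow rest" "X \<subseteq> rest" "X \<noteq> {}" "X \<notin> P"
  shows "insert v X \<in> stage P Q" "insert v (insert c X) \<in> stage P Q"
proof -
  have X: "finite X" "v \<notin> X" "c \<notin> X" "a \<notin> X" "b \<notin> X" "X \<subseteq> {1..n}"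
    using assms(2) finite_rest finite_subset by (auto simp: rest_def)
  have "card X > 0" using X assms by (simp add: card_gt_0_iff)
  then have c: "card (insert v X) \<ge> 2" "card (insert v (insert c X)) \<ge> 3" using X distinct by auto
  have P: "v \<notin> Y" "c \<notin> Y" if "Y \<in> P" for Y using that assms(1) by (auto simp: rest_def)
  have "insert v X \<notin> insert v ` P"
    using P X assms(4) by (metis (no_types, lifting) imageE insert_ident)
  moreover have "insert v X \<notin> (\<lambda>X. insert v (insert c X)) ` P" using X distinct by auto
  moreover have "insert v X \<notin> {{v, a}, {v, b}, {v, c}}" using X distinct assms(3) by auto
  ultimately show "insert v X \<in> stage P Q"
    using c X in_ground by (simp add: stage_def star_compatible_def)
  have "insert v (insert c X) \<noteq> insert v Y" if "Y \<in> P" for Y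
    using P[OF that] distinct by (metis insert_iff)
  then have "insert v (insert c X) \<notin> insert v ` P" by blast
  moreover have "insert v (insert c X) \<notin> (\<lambda>X. insert v (insert c X)) ` P"
  proof
    assume "insert v (insert c X) \<in> (\<lambda>X. insert v (insert c X)) ` P"
    then obtain Y where Y: "Y \<in> P" "insert v (insert c X) = insert v (insert c Y)" by auto
    then have "X = Y" using P X distinct by (metis insert_ident insert_iff)
    then show False using Y assms by simp
  qed
  moreover have "insert v (insert c X) \<notin> {{v, a}, {v, b}, {v, c}}" using c(2) distinct by auto
  ultimately show "insert v (insert c X) \<in> stage P Q"
    using c X in_ground by (simp add: stage_def star_compatible_def)
qed

lemma co_notin_stage:
  assumes "P \<subseteq> Pow rest" "Q \<subseteq> Pow rest" "X \<subseteq> rest" "X \<noteq> {}" "X \<notin> P \<union> Q"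
  shows "co X \<notin> stage P Q"
proof -
  have "co X \<notin> star_compatible" using co_mem[OF assms(3)] by (auto simp: star_compatible_def)
  moreover have "co X \<noteq> co {}" using inj_onD[OF inj_co, of X "{}"] assms by auto
  moreover have "co X \<notin> co ` (P \<union> Q)"
    using inj_on_image_mem_iff[OF inj_co, of X "P \<union> Q"] assms by auto
  ultimately show ?thesis by (auto simp: stage_def)
qed

section \<open>Passing from one stage to the next\<close>

text \<open>The complement contains \<open>a\<close>, \<open>b\<close>, \<open>c\<close> and avoids
  \<open>v\<close>, so it is compatible from the start and never deleted. It is the partner against
  which \<open>insert v X\<close> gets deleted.\<close>

lemma complement_in_stage:
  assumes "X \<subseteq> rest"
  shows "{1..n} - insert v X \<in> stage P Q"
proof -
  have abc: "a \<in> {1..n} - insert v X" "b \<in> {1..n} - insert v X" "c \<in> {1..n} - insert v X"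
    using assms in_ground distinct by (auto simp: rest_def)
  then have "card {a, b} \<le> card ({1..n} - insert v X)" by (intro card_mono) auto
  then have "{1..n} - insert v X \<in> star_compatible"
    using abc distinct by (auto simp: star_compatible_def)
  then show ?thesis by (auto simp: stage_def)
qed

text \<open>If all smaller sets \<open>insert v Y\<close> are gone, then \<open>insert v X\<close> is the only set its complement misses.\<close>

lemma delete_left:
  fixes \<delta> :: real
  assumes PQ: "P \<subseteq> Pow rest" "Q \<subseteq> Pow rest" and X: "X \<subseteq> rest" "X \<noteq> {}" "X \<notin> P"
    and small: "\<And>Y. Y \<subset> X \<Longrightarrow> Y \<noteq> {} \<Longrightarrow> Y \<in> P"
    and \<delta>: "real (Suc J) \<le> \<delta> * real (card bath + 1)"
  shows "nisf (Suc J) (stage P Q) \<le> (1 + min \<delta> 1) * nisf (Suc J) (stage P Q - {insert v X})"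
proof (rule nisf_delete_complement[OF finite_stage[OF PQ] bath_sub[OF PQ(1)] bath_meets[OF PQ]])
  show "insert v X \<in> stage P Q" using left_in_stage[OF PQ(1) X] by simp
  show "insert v X \<notin> bath" using X distinct by (auto simp: bath_def rest_def)
  show "{1..n} - insert v X \<in> stage P Q" by (rule complement_in_stage[OF X(1)])
  show "{1..n} - insert v X \<noteq> {}" using X(1) in_ground distinct by (auto simp: rest_def)
  show "A \<inter> ({1..n} - insert v X) \<noteq> {}" if A: "A \<in> stage P Q - {insert v X}" for A
  proof
    assume "A \<inter> ({1..n} - insert v X) = {}"
    then have sub: "A \<subseteq> insert v X" using stage_mem(1)[OF PQ, of A] A by auto
    then have "A \<subseteq> insert v (insert c X)" by auto
    then obtain Y where Y: "Y \<subseteq> X" "Y \<noteq> {}" "Y \<notin> P" "A = insert v Y \<or> A = insert v (insert c Y)"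
      using A stage_small[OF PQ _ X(1), of A] by blast
    then have "Y = X" using small by blast
    moreover have "c \<notin> insert v X" using X(1) distinct by (auto simp: rest_def)
    ultimately show False using Y A sub by auto
  qed
qed (use \<delta> in auto)

text \<open>Once all smaller sets are processed, the only members that \<open>co X\<close> misses
  are \<open>insert v X\<close> and \<open>insert v (insert c X)\<close>. The first is deleted at
  the cost \<open>1 + min \<delta> 1\<close>; then the second is switched for \<open>co X\<close>
  without loss.\<close>

lemma process:
  fixes \<delta> :: real
  assumes P: "P \<subseteq> Pow rest" and X: "X \<subseteq> rest" "X \<noteq> {}" "X \<notin> P"
    and small: "\<And>Y. Y \<subset> X \<Longrightarrow> Y \<noteq> {} \<Longrightarrow> Y \<in> P"
    and \<delta>: "real (Suc J) \<le> \<delta> * real (card bath + 1)" "0 \<le> \<delta>"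
  shows "nisf (Suc J) (stage P {}) \<le> (1 + min \<delta> 1) * nisf (Suc J) (stage (insert X P) {})"
proof -
  let ?S = "stage P {}" and ?Z = "insert v X" and ?Zc = "insert v (insert c X)"
  have Q: "{} \<subseteq> Pow rest" by simp
  have cX: "c \<notin> X" "v \<notin> X" using X(1) by (auto simp: rest_def)
  have "nisf (Suc J) (?S - {?Z}) \<le> nisf (Suc J) (insert (co X) (?S - {?Z} - {?Zc}))"
  proof (rule nisf_switch)
    show "finite (?S - {?Z})" using finite_stage[OF P Q] by simp
    have "?Zc \<noteq> ?Z" using cX distinct by (metis insert_iff)
    then show "?Zc \<in> ?S - {?Z}" using left_in_stage[OF P X] by simp
    show "co X \<notin> ?S - {?Z}" using co_notin_stage[OF P Q X(1,2)] X by simp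
    show "co X \<noteq> {}" using co_mem[OF X(1)] by auto
    show "A \<inter> co X \<noteq> {}" if A: "A \<in> ?S - {?Z} - {?Zc}" for A
    proof
      assume "A \<inter> co X = {}"
      then have "A \<subseteq> ?Zc" using stage_mem(1)[OF P Q, of A] A by (auto simp: co_def)
      then obtain Y where "Y \<subseteq> X" "Y \<noteq> {}" "Y \<notin> P" "A = insert v Y \<or> A = insert v (insert c Y)"
        using A stage_small[OF P Q _ X(1), of A] by blast
      moreover from this have "Y = X" using small by blast
      ultimately show False using A by auto
    qed
  qed auto
  also have "insert (co X) (?S - {?Z} - {?Zc}) = stage (insert X P) {}"
  proof -
    have "v \<notin> co Y" if "Y \<in> P" for Y using that P co_mem by blast
    then have "?Z \<notin> co ` P" "?Zc \<notin> co ` P" by auto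
    then show ?thesis by (auto simp: stage_def)
  qed
  finally have "real (nisf (Suc J) (?S - {?Z})) \<le> nisf (Suc J) (stage (insert X P) {})" by simp
  then have "(1 + min \<delta> 1) * nisf (Suc J) (?S - {?Z}) \<le> (1 + min \<delta> 1) * nisf (Suc J) (stage (insert X P) {})"
    using \<delta>(2) by (intro mult_left_mono) auto
  then show ?thesis using delete_left[OF P Q X small \<delta>(1)] by linarith
qed

text \<open>Sets are processed from small to large: the induction splits off a maximal one, which
  keeps the rest closed under nonempty subsets.\<close>

lemma process_all:
  fixes \<delta> :: real
  assumes \<delta>: "real (Suc J) \<le> \<delta> * real (card bath + 1)" "0 \<le> \<delta>"
    and P: "P \<subseteq> Pow rest" "{} \<notin> P" "\<And>X Y. X \<in> P \<Longrightarrow> Y \<subset> X \<Longrightarrow> Y \<noteq> {} \<Longrightarrow> Y \<in> P"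
  shows "nisf (Suc J) (stage {} {}) \<le> (1 + min \<delta> 1) ^ card P * nisf (Suc J) (stage P {})"
  using P
proof (induction "card P" arbitrary: P)
  case 0
  then have "P = {}" using finite_rest finite_subset[of P "Pow rest"] by auto
  then show ?case by simp
next
  case (Suc k)
  have fin: "finite P" using Suc.prems(1) finite_rest finite_subset by blast
  moreover have "P \<noteq> {}" using Suc.hyps(2) by auto
  ultimately obtain X where X: "X \<in> P" "\<And>Y. Y \<in> P \<Longrightarrow> X \<le> Y \<Longrightarrow> X = Y"
    using finite_has_maximal[of P] by blast
  let ?P = "P - {X}"
  have ins: "insert X ?P = P" using X(1) by auto
  have k: "k = card ?P" using Suc.hyps(2) X(1) fin by simp
  have "nisf (Suc J) (stage {} {}) \<le> (1 + min \<delta> 1) ^ card ?P * nisf (Suc J) (stage ?P {})"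
  proof (rule Suc.hyps(1)[OF k])
    fix Y Z assume "Y \<in> ?P" "Z \<subset> Y" "Z \<noteq> {}"
    then show "Z \<in> ?P" using Suc.prems(3)[of Y Z] X(2)[of Y] by blast
  qed (use Suc.prems in auto)
  also have "\<dots> \<le> (1 + min \<delta> 1) ^ card ?P * ((1 + min \<delta> 1) * nisf (Suc J) (stage (insert X ?P) {}))"
  proof (intro mult_left_mono process[OF _ _ _ _ _ \<delta>])
    show "Y \<in> ?P" if "Y \<subset> X" "Y \<noteq> {}" for Y using Suc.prems(3)[OF X(1) that] that by auto
  qed (use Suc.prems X \<delta> in auto)
  also have "\<dots> = (1 + min \<delta> 1) ^ card P * nisf (Suc J) (stage P {})"
    unfolding ins using Suc.hyps(2)[symmetric] k[symmetric] by (simp add: mult.assoc mult.left_commute)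
  finally show ?case .
qed

lemma stage_insert: "stage P (insert X Q) = insert (co X) (stage P Q)"
  by (auto simp: stage_def)

lemma missed_by_co:
  assumes PQ: "P \<subseteq> Pow rest" "Q \<subseteq> Pow rest"
  shows "{A \<in> stage P Q. A \<inter> co X = {}} = {A \<in> stage P Q. A \<subseteq> insert v (insert c X)}"
  using stage_mem(1)[OF PQ] by (fastforce simp: co_def)

text \<open>Of the two members missed by \<open>co X\<close>, deleting \<open>insert v X\<close>
  leaves at least the proportion \<open>1 / (1 + min \<delta> 1)\<close>, and
  \<open>insert v (insert c X)\<close> takes the part of \<open>Z\<close> in
  \<open>nisf_add\<close>.\<close>

lemma add_level:
  fixes \<delta> \<rho> :: real
  assumes PQ: "P \<subseteq> Pow rest" "Q \<subseteq> Pow rest" and X: "X \<subseteq> rest" "X \<noteq> {}" "X \<notin> P \<union> Q"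
    and small: "\<And>Y. Y \<subset> X \<Longrightarrow> Y \<noteq> {} \<Longrightarrow> Y \<in> P"
    and \<delta>: "real (Suc J) \<le> \<delta> * real (card bath + 1)" "0 \<le> \<delta>"
    and \<rho>: "\<rho> * (5 * 2 ^ (n - 3)) \<le> real (Suc J)" "0 \<le> \<rho>"
  shows "(1 + \<rho> / (1 + min \<delta> 1)) * nisf (Suc J) (stage P Q) \<le> nisf (Suc J) (stage P (insert X Q))"
proof -
  let ?Z = "insert v X" and ?Zc = "insert v (insert c X)"
  have cX: "c \<notin> X" using X(1) by (auto simp: rest_def)
  have left: "?Z \<in> stage P Q" "?Zc \<in> stage P Q" using left_in_stage[OF PQ(1) X(1,2)] X by auto
  have D: "{A \<in> stage P Q. A \<inter> co X = {}} = insert ?Zc {?Z}"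
  proof -
    have "A \<in> insert ?Zc {?Z}" if A: "A \<in> stage P Q" "A \<subseteq> ?Zc" for A
    proof -
      obtain Y where "Y \<subseteq> X" "Y \<noteq> {}" "Y \<notin> P" "A = insert v Y \<or> A = insert v (insert c Y)"
        using stage_small[OF PQ A(1) X(1) A(2)] by blast
      moreover from this have "Y = X" using small by blast
      ultimately show ?thesis by auto
    qed
    then show ?thesis unfolding missed_by_co[OF PQ] using left by auto
  qed
  have \<rho>': "\<rho> * real (card (stage P Q)) \<le> real (Suc J)"
  proof -
    have "real (card (stage P Q)) \<le> real (5 * 2 ^ (n - 3))"
      using card_stage[OF PQ] by (simp only: of_nat_le_iff)
    then have "\<rho> * real (card (stage P Q)) \<le> \<rho> * (5 * 2 ^ (n - 3))"
      by (intro mult_left_mono[OF _ \<rho>(2)]) simp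
    then show ?thesis using \<rho>(1) by linarith
  qed
  have "(1 + \<rho> * (1 / (1 + min \<delta> 1))) * nisf (Suc J) (stage P Q) \<le> nisf (Suc J) (insert (co X) (stage P Q))"
  proof (rule nisf_add[OF finite_stage[OF PQ] _ _ D _ _ \<rho>' \<rho>(2)])
    show "co X \<notin> stage P Q" by (rule co_notin_stage[OF PQ X])
    show "co X \<noteq> {}" using co_mem[OF X(1)] by auto
    show "?Zc \<notin> {?Z}" using cX distinct by (metis insert_iff singletonD)
    have "nisf (Suc J) (stage P Q) \<le> (1 + min \<delta> 1) * nisf (Suc J) (stage P Q - {?Z})"
      using X by (intro delete_left[OF PQ _ _ _ small \<delta>(1)]) auto
    then show "1 / (1 + min \<delta> 1) * nisf (Suc J) (stage P Q) \<le> nisf (Suc J) (stage P Q - {?Z})"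
      using \<delta>(2) by (simp add: divide_le_eq mult.commute)
  qed auto
  then show ?thesis by (simp add: stage_insert)
qed

text \<open>Smaller sets may still be present here. All members missed by \<open>co X\<close>
  contain \<open>v\<close> and lie inside \<open>insert v (insert c X)\<close>, so there are at most
  \<open>2 ^ Suc r\<close>; each deletion costs a factor \<open>1 - \<delta>\<close>.\<close>

lemma add_sparse:
  fixes \<delta> \<rho> :: real
  assumes PQ: "P \<subseteq> Pow rest" "Q \<subseteq> Pow rest" and X: "X \<subseteq> rest" "X \<noteq> {}" "X \<notin> P \<union> Q" "card X \<le> r"
    and \<delta>: "real (Suc J) \<le> \<delta> * real (card bath + 1)" "0 \<le> \<delta>" "\<delta> \<le> 1"
    and \<rho>: "\<rho> * (5 * 2 ^ (n - 3)) \<le> real (Suc J)" "0 \<le> \<rho>"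
  shows "(1 + \<rho> * (1 - \<delta>) ^ (2 ^ Suc r)) * nisf (Suc J) (stage P Q) \<le> nisf (Suc J) (stage P (insert X Q))"
proof -
  let ?Zc = "insert v (insert c X)"
  let ?D = "{A \<in> stage P Q. A \<subseteq> ?Zc} - {?Zc}"
  have fX: "finite X" "c \<notin> X" "a \<notin> X" "b \<notin> X" using X(1) finite_rest finite_subset by (auto simp: rest_def)
  have left: "?Zc \<in> stage P Q" using left_in_stage[OF PQ(1) X(1,2)] X by auto
  have D: "{A \<in> stage P Q. A \<inter> co X = {}} = insert ?Zc ?D"
    unfolding missed_by_co[OF PQ] using left by auto
  have "?D \<subseteq> insert v ` Pow (insert c X)"
  proof
    fix A assume A: "A \<in> ?D"
    then have "A \<subseteq> ?Zc" by simp
    then have "v \<in> A" using A stage_mem(2)[OF PQ, of A] fX distinct by auto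
    then have "A = insert v (A - {v})" "A - {v} \<subseteq> insert c X" using \<open>A \<subseteq> ?Zc\<close> by auto
    then show "A \<in> insert v ` Pow (insert c X)" by blast
  qed
  then have "card ?D \<le> card (insert v ` Pow (insert c X))" using fX by (intro card_mono) auto
  also have "\<dots> \<le> card (Pow (insert c X))" using fX by (intro card_image_le) auto
  also have "\<dots> = 2 ^ Suc (card X)" using fX by (simp add: card_Pow)
  also have "\<dots> \<le> 2 ^ Suc r" using X(4) by (intro power_increasing) auto
  finally have cD: "card ?D \<le> 2 ^ Suc r" .
  have \<rho>': "\<rho> * real (card (stage P Q)) \<le> real (Suc J)"
  proof -
    have "real (card (stage P Q)) \<le> real (5 * 2 ^ (n - 3))"
      using card_stage[OF PQ] by (simp only: of_nat_le_iff)
    then have "\<rho> * real (card (stage P Q)) \<le> \<rho> * (5 * 2 ^ (n - 3))"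
      by (intro mult_left_mono[OF _ \<rho>(2)]) simp
    then show ?thesis using \<rho>(1) by linarith
  qed
  have "(1 + \<rho> * (1 - \<delta>) ^ (2 ^ Suc r)) * nisf (Suc J) (stage P Q) \<le> nisf (Suc J) (insert (co X) (stage P Q))"
  proof (rule nisf_add[OF finite_stage[OF PQ] _ _ D _ _ \<rho>' \<rho>(2)])
    show "co X \<notin> stage P Q" by (rule co_notin_stage[OF PQ X(1-3)])
    show "co X \<noteq> {}" using co_mem[OF X(1)] by auto
    have "(1 - \<delta>) ^ (2 ^ Suc r) \<le> (1 - \<delta>) ^ card ?D"
      using cD \<delta> by (intro power_decreasing) auto
    then have "(1 - \<delta>) ^ (2 ^ Suc r) * nisf (Suc J) (stage P Q) \<le> (1 - \<delta>) ^ card ?D * nisf (Suc J) (stage P Q)"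
      by (rule mult_right_mono) simp
    also have "\<dots> \<le> nisf (Suc J) (stage P Q - ?D)"
    proof (rule nisf_delete_set[OF finite_stage[OF PQ] bath_sub[OF PQ(1)] bath_meets[OF PQ]])
      show "finite ?D" using finite_stage[OF PQ] by simp
      show "?D \<inter> bath = {}" using fX distinct by (auto simp: bath_def)
      show "{} \<notin> ?D" using stage_mem(2)[OF PQ] by auto
    qed (use \<delta> in auto)
    finally show "(1 - \<delta>) ^ (2 ^ Suc r) * nisf (Suc J) (stage P Q) \<le> nisf (Suc J) (stage P Q - ?D)" .
  qed auto
  then show ?thesis by (simp add: stage_insert)
qed

lemma add_all:
  fixes f :: real
  assumes "finite Q" "0 \<le> f"
    and step: "\<And>X Q'. X \<in> Q \<Longrightarrow> Q' \<subseteq> Q \<Longrightarrow> X \<notin> Q' \<Longrightarrow>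
      f * nisf (Suc J) (stage P Q') \<le> nisf (Suc J) (stage P (insert X Q'))"
  shows "f ^ card Q * nisf (Suc J) (stage P {}) \<le> nisf (Suc J) (stage P Q)"
proof -
  have "f ^ card Q' * nisf (Suc J) (stage P {}) \<le> nisf (Suc J) (stage P Q')" if "finite Q'" "Q' \<subseteq> Q" for Q'
    using that
  proof (induction Q' rule: finite_induct)
    case (insert X Q')
    have "f ^ card (insert X Q') * nisf (Suc J) (stage P {}) = f * (f ^ card Q' * nisf (Suc J) (stage P {}))"
      using insert.hyps by simp
    also have "\<dots> \<le> f * nisf (Suc J) (stage P Q')" using insert assms(2) by (intro mult_left_mono) auto
    also have "\<dots> \<le> nisf (Suc J) (stage P (insert X Q'))" using insert by (intro step) auto
    finally show ?case .
  qed simp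
  then show ?thesis using assms(1) by simp
qed

section \<open>Reaching the pair-compatible sets, and the total gain\<close>

text \<open>Processing the singletons removes the last 2-sets through \<open>v\<close>, and a
  compatible set avoiding \<open>v\<close> contains \<open>a\<close>, \<open>b\<close>,
  \<open>c\<close>. The sets \<open>co X\<close> are large: with \<open>card X \<le> 8\<close> they
  have at least 21 - 10 elements.\<close>

lemma stage_pair_compatible:
  assumes PQ: "P \<subseteq> Pow rest" "Q \<subseteq> Pow rest" and single: "\<And>x. x \<in> rest \<Longrightarrow> {x} \<in> P"
    and small: "\<And>X. X \<in> P \<union> Q \<Longrightarrow> card X \<le> 8"
  shows "stage P Q \<subseteq> pair_compatible"
proof
  fix Z assume Z: "Z \<in> stage P Q"
  have co_card: "3 \<le> card (co X)" if "X \<subseteq> rest" "card X \<le> 8" for X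
  proof -
    have "finite X" using that finite_rest finite_subset by auto
    then have "card (insert v (insert c X)) \<le> 10" using that by (simp add: card_insert_if)
    then have "card {1..n} - card (insert v (insert c X)) \<ge> 3" using n by simp
    moreover have "card (co X) \<ge> card {1..n} - card (insert v (insert c X))"
      unfolding co_def using \<open>finite X\<close> by (intro diff_card_le_card_Diff) auto
    ultimately show ?thesis by linarith
  qed
  have "3 \<le> card Z"
  proof (cases "\<exists>X \<subseteq> rest. card X \<le> 8 \<and> Z = co X")
    case False
    have "Z \<notin> co ` insert {} (P \<union> Q)"
    proof
      assume "Z \<in> co ` insert {} (P \<union> Q)"
      then obtain X where X: "X \<in> insert {} (P \<union> Q)" "Z = co X" by blast
      then have "X \<subseteq> rest" "card X \<le> 8" using PQ small by auto
      then show False using False X by blast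
    qed
    then have S: "Z \<in> star_compatible" "Z \<notin> insert v ` P"
      using Z unfolding stage_def by auto
    then have fin: "finite Z" by (auto simp: star_compatible_def intro: finite_subset)
    show ?thesis
    proof (cases "v \<in> Z")
      case True
      have "card Z \<noteq> 2"
      proof
        assume "card Z = 2"
        then obtain y where y: "Z = {v, y}" "y \<noteq> v" using True by (auto simp: card_2_iff)
        then have "y \<in> rest" using S(1) by (auto simp: star_compatible_def rest_def)
        then have "insert v {y} \<in> insert v ` P" using single by blast
        then show False using S(2) y by simp
      qed
      then show ?thesis using S(1) by (auto simp: star_compatible_def)
    next
      case False
      then have "{a, b, c} \<subseteq> Z" using S(1) by (auto simp: star_compatible_def)
      then have "card {a, b, c} \<le> card Z" using fin by (intro card_mono) auto
      then show ?thesis using distinct by simp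
    qed
  qed (use co_card in auto)
  then show "Z \<in> pair_compatible" using stage_mem[OF PQ Z] by (auto simp: pair_compatible_def)
qed

definition below :: "nat \<Rightarrow> nat set set" where
  "below r = {X. X \<subseteq> rest \<and> X \<noteq> {} \<and> card X < r}"

lemma below_sub: "below r \<subseteq> Pow rest" by (auto simp: below_def)

lemma card_below: "card (below r) = (\<Sum>i=1..<r. (n - 4) choose i)"
proof -
  have eq: "below r = (\<Union>i\<in>{1..<r}. {X. X \<subseteq> rest \<and> card X = i})"
    using finite_rest finite_subset by (fastforce simp: below_def card_gt_0_iff Suc_le_eq)
  have "card (below r) = (\<Sum>i=1..<r. card {X. X \<subseteq> rest \<and> card X = i})"
    unfolding eq using finite_rest by (intro card_UN_disjoint) auto
  then show ?thesis by (simp add: n_subsets[OF finite_rest] card_rest)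
qed

lemma nisf_pair_ge:
  assumes "2 \<le> r" "r \<le> 9" "Q \<subseteq> Pow rest" "\<And>X. X \<in> Q \<Longrightarrow> card X \<le> 8"
  shows "nisf s (stage (below r) Q) \<le> nisf s pair_compatible"
proof (rule nisf_mono)
  show "finite pair_compatible"
    by (rule finite_subset[of _ "Pow {1..n}"]) (auto simp: pair_compatible_def)
  show "stage (below r) Q \<subseteq> pair_compatible"
    using assms by (intro stage_pair_compatible below_sub) (auto simp: below_def)
qed

lemma level_gain:
  fixes \<delta> \<rho> :: real
  assumes r: "2 \<le> r" "r \<le> 8"
    and \<delta>: "real (Suc J) \<le> \<delta> * real (card bath + 1)" "0 \<le> \<delta>"
    and \<rho>: "\<rho> * (5 * 2 ^ (n - 3)) \<le> real (Suc J)" "0 \<le> \<rho>"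
  shows "(1 + \<rho> / (1 + min \<delta> 1)) ^ ((n - 4) choose r) * nisf (Suc J) (stage {} {})
    \<le> (1 + min \<delta> 1) ^ (\<Sum>i=1..<r. (n - 4) choose i) * nisf (Suc J) pair_compatible"
proof -
  let ?Q = "{X. X \<subseteq> rest \<and> card X = r}" and ?f = "1 + \<rho> / (1 + min \<delta> 1)" and ?g = "1 + min \<delta> 1"
  have nonneg: "0 \<le> ?f" "0 \<le> ?g" using \<rho> \<delta> by auto
  have fin: "finite X" if "X \<subseteq> rest" for X using that finite_rest finite_subset by auto
  have Q: "?f ^ card ?Q * nisf (Suc J) (stage (below r) {}) \<le> nisf (Suc J) (stage (below r) ?Q)"
  proof (rule add_all)
    show "finite ?Q" using finite_rest by simp
    fix X Q' assume X: "X \<in> ?Q" "Q' \<subseteq> ?Q" "X \<notin> Q'"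
    show "?f * nisf (Suc J) (stage (below r) Q') \<le> nisf (Suc J) (stage (below r) (insert X Q'))"
    proof (rule add_level[OF below_sub _ _ _ _ _ \<delta> \<rho>])
      show "Y \<in> below r" if "Y \<subset> X" "Y \<noteq> {}" for Y
        using that X fin psubset_card_mono[of X Y] by (auto simp: below_def)
    qed (use X r in \<open>auto simp: below_def\<close>)
  qed (use nonneg in auto)
  have "nisf (Suc J) (stage {} {}) \<le> ?g ^ card (below r) * nisf (Suc J) (stage (below r) {})"
  proof (rule process_all[OF \<delta> below_sub])
    fix X Y assume X: "X \<in> below r" "Y \<subset> X" "Y \<noteq> {}"
    then have "card Y < card X" using fin by (intro psubset_card_mono) (auto simp: below_def)
    then show "Y \<in> below r" using X by (auto simp: below_def)
  qed (auto simp: below_def)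
  then have "?f ^ card ?Q * nisf (Suc J) (stage {} {})
      \<le> ?f ^ card ?Q * (?g ^ card (below r) * nisf (Suc J) (stage (below r) {}))"
    using nonneg by (intro mult_left_mono) auto
  also have "\<dots> = ?g ^ card (below r) * (?f ^ card ?Q * nisf (Suc J) (stage (below r) {}))" by simp
  also have "\<dots> \<le> ?g ^ card (below r) * nisf (Suc J) (stage (below r) ?Q)"
    using Q nonneg by (intro mult_left_mono) auto
  also have "\<dots> \<le> ?g ^ card (below r) * nisf (Suc J) pair_compatible"
  proof (intro mult_left_mono)
    show "real (nisf (Suc J) (stage (below r) ?Q)) \<le> real (nisf (Suc J) pair_compatible)"
      unfolding of_nat_le_iff using r by (intro nisf_pair_ge) auto
  qed (use nonneg in auto)
  finally show ?thesis by (simp add: card_below n_subsets[OF finite_rest] card_rest)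
qed

lemma sparse_gain:
  fixes \<delta> \<rho> :: real
  assumes r: "3 \<le> r" "r \<le> 8"
    and \<delta>: "real (Suc J) \<le> \<delta> * real (card bath + 1)" "0 \<le> \<delta>" "\<delta> \<le> 1"
    and \<rho>: "\<rho> * (5 * 2 ^ (n - 3)) \<le> real (Suc J)" "0 \<le> \<rho>"
  shows "(1 + \<rho> * (1 - \<delta>) ^ (2 ^ Suc r)) ^ ((n - 3) choose r) * nisf (Suc J) (stage {} {})
    \<le> (1 + \<delta>) ^ (n - 4) * nisf (Suc J) pair_compatible"
proof -
  let ?Q = "{X. X \<subseteq> rest \<and> card X = r - 1} \<union> {X. X \<subseteq> rest \<and> card X = r}"
    and ?f = "1 + \<rho> * (1 - \<delta>) ^ (2 ^ Suc r)" and ?g = "1 + min \<delta> 1"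
  have nonneg: "0 \<le> ?f" "0 \<le> ?g" using \<rho> \<delta> by auto
  have fin: "finite X" if "X \<subseteq> rest" for X using that finite_rest finite_subset by auto
  have "n - 3 = Suc (n - 4)" "r = Suc (r - 1)" using n r by auto
  then have "(n - 3) choose r = ((n - 4) choose (r - 1)) + ((n - 4) choose r)"
    using binomial_Suc_Suc[of "n - 4" "r - 1"] by simp
  moreover have "card ?Q = ((n - 4) choose (r - 1)) + ((n - 4) choose r)"
    using r finite_rest by (subst card_Un_disjoint) (auto simp: n_subsets[OF finite_rest] card_rest)
  ultimately have cQ: "card ?Q = (n - 3) choose r" by simp
  have Q: "?f ^ card ?Q * nisf (Suc J) (stage (below 2) {}) \<le> nisf (Suc J) (stage (below 2) ?Q)"
  proof (rule add_all)
    show "finite ?Q" using finite_rest by simp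
    fix X Q' assume X: "X \<in> ?Q" "Q' \<subseteq> ?Q" "X \<notin> Q'"
    show "?f * nisf (Suc J) (stage (below 2) Q') \<le> nisf (Suc J) (stage (below 2) (insert X Q'))"
      by (rule add_sparse[OF below_sub _ _ _ _ _ \<delta> \<rho>]) (use X r in \<open>auto simp: below_def\<close>)
  qed (use nonneg in auto)
  have "nisf (Suc J) (stage {} {}) \<le> ?g ^ card (below 2) * nisf (Suc J) (stage (below 2) {})"
  proof (rule process_all[OF \<delta>(1,2) below_sub])
    fix X Y assume X: "X \<in> below 2" "Y \<subset> X" "Y \<noteq> {}"
    then have "card Y < card X" using fin by (intro psubset_card_mono) (auto simp: below_def)
    then show "Y \<in> below 2" using X by (auto simp: below_def)
  qed (auto simp: below_def)
  then have "?f ^ card ?Q * nisf (Suc J) (stage {} {})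
      \<le> ?f ^ card ?Q * (?g ^ card (below 2) * nisf (Suc J) (stage (below 2) {}))"
    using nonneg by (intro mult_left_mono) auto
  also have "\<dots> = ?g ^ card (below 2) * (?f ^ card ?Q * nisf (Suc J) (stage (below 2) {}))" by simp
  also have "\<dots> \<le> ?g ^ card (below 2) * nisf (Suc J) (stage (below 2) ?Q)"
    using Q nonneg by (intro mult_left_mono) auto
  also have "\<dots> \<le> ?g ^ card (below 2) * nisf (Suc J) pair_compatible"
  proof (intro mult_left_mono)
    show "real (nisf (Suc J) (stage (below 2) ?Q)) \<le> real (nisf (Suc J) pair_compatible)"
      unfolding of_nat_le_iff using r by (intro nisf_pair_ge) auto
  qed (use nonneg in auto)
  finally show ?thesis using \<delta> cQ by (simp add: card_below numeral_2_eq_2 min_absorb1)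
qed

text \<open>Here \<open>co {}\<close> takes the place of \<open>{v, c}\<close>, so that
  \<open>Suc J\<close> sets accompany \<open>{v, a}\<close> and \<open>{v, b}\<close>. It meets
  every compatible set because no subset of \<open>{v, c}\<close> is compatible.\<close>

lemma start_gain:
  "real (card bath + 1) * nisf J star_compatible \<le> real (Suc J) * nisf (Suc J) (stage {} {})"
  "nisf J star_compatible \<le> nisf (Suc J) (stage {} {})"
proof -
  have eq: "stage {} {} = insert (co {}) star_compatible" by (simp add: stage_def)
  have co: "co {} \<notin> star_compatible" "co {} \<noteq> {}"
    using co_mem[of "{}"] by (auto simp: star_compatible_def)
  have meets: "A \<inter> co {} \<noteq> {}" if "A \<in> star_compatible" for A
  proof
    assume "A \<inter> co {} = {}"
    moreover have "A \<subseteq> {1..n}" using that by (simp add: star_compatible_def)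
    ultimately have sub: "A \<subseteq> {v, c}" unfolding co_def by blast
    then have "v \<in> A" using that distinct by (auto simp: star_compatible_def)
    then have "A = {v} \<or> A = {v, c}" using sub by auto
    then show False using that by (auto simp: star_compatible_def)
  qed
  have bath: "g \<inter> A \<noteq> {}" if "g \<in> bath" "A \<in> star_compatible" for g A
    using that bath_meets[of "{}" "{}" g A] by (simp add: eq)
  note * = nisf_bath_start[OF finite_star_compatible bath_sub_star bath co meets]
  show "real (card bath + 1) * nisf J star_compatible \<le> real (Suc J) * nisf (Suc J) (stage {} {})"
    unfolding eq by (rule *(1))
  show "nisf J star_compatible \<le> nisf (Suc J) (stage {} {})"
    unfolding eq by (rule *(2))
qed

end

section \<open>Numerical estimates\<close>

lemma power_le_fact_binomial: "(N + 1 - t) ^ t \<le> fact t * (N choose t)"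
proof (induction t arbitrary: N)
  case (Suc t)
  show ?case
  proof (cases N)
    case (Suc M)
    have "(N + 1 - Suc t) ^ Suc t = (M + 1 - t) * (M + 1 - t) ^ t" using Suc by simp
    also have "\<dots> \<le> Suc M * (fact t * (M choose t))" using Suc.IH[of M] by (intro mult_le_mono) auto
    also have "\<dots> = fact t * (Suc t * (Suc M choose Suc t))"
      unfolding Suc_times_binomial by (rule mult.left_commute)
    also have "\<dots> = fact (Suc t) * (N choose Suc t)"
    by (simp add: Suc mult_ac del: mult_Suc mult_Suc_right binomial_Suc_Suc)
    finally show ?thesis .
  qed simp
qed simp

text \<open>The leading factor of the falling factorial is kept exact: it is the one that is
  compared with \<open>triple_bound n\<close>, so the estimates hold uniformly in
  \<open>n\<close>.\<close>

lemma times_power_le_fact_binomial: "N * (N - t) ^ t \<le> fact (Suc t) * (N choose Suc t)"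
proof (cases N)
  case (Suc M)
  have "N * (N - t) ^ t = Suc M * (M + 1 - t) ^ t" using Suc by simp
  also have "\<dots> \<le> Suc M * (fact t * (M choose t))" by (intro mult_le_mono power_le_fact_binomial) simp
  also have "\<dots> = fact t * (Suc t * (Suc M choose Suc t))"
    unfolding Suc_times_binomial by (rule mult.left_commute)
  also have "\<dots> = fact (Suc t) * (N choose Suc t)"
    by (simp add: Suc mult_ac del: mult_Suc mult_Suc_right binomial_Suc_Suc)
  finally show ?thesis .
qed simp

text \<open>Keep one term of the binomial expansion. If \<open>N\<close> is at most
  \<open>t\<close>, the left side is 0, by truncation of \<open>N - t\<close> or because
  \<open>N = 0\<close>.\<close>

lemma binomial_term_le_power:
  fixes x :: real
  assumes "0 \<le> x"
  shows "real N * real (N - t) ^ t / fact (Suc t) * x ^ Suc t \<le> (1 + x) ^ N"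
proof (cases "Suc t \<le> N")
  case True
  have "real (N * (N - t) ^ t) \<le> real (fact (Suc t) * (N choose Suc t))"
    using times_power_le_fact_binomial by (simp only: of_nat_le_iff)
  then have "real N * real (N - t) ^ t \<le> fact (Suc t) * real (N choose Suc t)"
    by (simp only: of_nat_mult of_nat_power of_nat_fact)
  then have "real N * real (N - t) ^ t / fact (Suc t) \<le> real (N choose Suc t)"
    by (simp only: divide_le_eq fact_gt_zero if_True mult.commute)
  then have "real N * real (N - t) ^ t / fact (Suc t) * x ^ Suc t \<le> real (N choose Suc t) * x ^ Suc t"
    using assms by (intro mult_right_mono) auto
  also have "\<dots> = (\<Sum>k\<in>{Suc t}. real (N choose k) * x ^ k * 1 ^ (N - k))" by simp
  also have "\<dots> \<le> (\<Sum>k\<le>N. real (N choose k) * x ^ k * 1 ^ (N - k))"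
    using True assms by (intro sum_mono2) auto
  also have "\<dots> = (x + 1) ^ N" by (rule binomial_ring[symmetric])
  finally show ?thesis by (simp add: add.commute)
next
  case False
  show ?thesis
  proof (cases "t = 0")
    case True
    then show ?thesis using False by (cases N) auto
  next
    case t: False
    then have "real N * real (N - t) ^ t / fact (Suc t) * x ^ Suc t = 0" using False by simp
    moreover have "0 \<le> (1 + x) ^ N" using assms by simp
    ultimately show ?thesis by linarith
  qed
qed

text \<open>Induction as for Bernoulli's inequality, now keeping three terms and dropping the cubic
  one that each step produces.\<close>

lemma quadratic_le_power:
  fixes x :: real
  assumes "0 \<le> x"
  shows "1 + real N * x + real N * (real N - 1) / 2 * x\<^sup>2 \<le> (1 + x) ^ N"
proof (induction N)
  case (Suc N)
  have "0 \<le> real N * (real N - 1)" by (cases N) auto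
  then have "0 \<le> real N * (real N - 1) / 2 * x\<^sup>2 * x" using assms by simp
  then have "1 + real (Suc N) * x + real (Suc N) * (real (Suc N) - 1) / 2 * x\<^sup>2
      \<le> (1 + real N * x + real N * (real N - 1) / 2 * x\<^sup>2) * (1 + x)"
    by (simp add: field_simps power2_eq_square)
  also have "\<dots> \<le> (1 + x) ^ N * (1 + x)" using Suc assms by (intro mult_right_mono) auto
  finally show ?case by (simp add: mult.commute)
qed simp

text \<open>The factors lost to the deletions are absorbed by \<open>p * q\<close> of the \<open>M\<close> factors gained.\<close>

lemma absorb_power:
  fixes x y g :: real
  assumes "0 \<le> y" "y \<le> x" "0 < g" "g \<le> (1 + y) ^ p" "p * q \<le> M"
    and "t < (1 + y) ^ (M - p * q)"
  shows "t * g ^ q < (1 + x) ^ M"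
proof -
  have "t * g ^ q < (1 + y) ^ (M - p * q) * g ^ q" using assms by simp
  also have "\<dots> \<le> (1 + y) ^ (M - p * q) * ((1 + y) ^ p) ^ q"
    using assms by (intro mult_left_mono power_mono) auto
  also have "\<dots> = (1 + y) ^ M" using assms(5) by (simp add: power_mult[symmetric] power_add[symmetric])
  also have "\<dots> \<le> (1 + x) ^ M" using assms by (intro power_mono) auto
  finally show ?thesis .
qed

section \<open>The number of triples against the numbers of factors gained\<close>

text \<open>This is \<open>n * ((n - 1) choose 3) + (n choose 3)\<close>, the number of stars plus
  the number of triangles, as a real polynomial.\<close>

definition triple_bound :: "nat \<Rightarrow> real" where
  "triple_bound n = real n * (real n - 1) * (real n - 2)\<^sup>2 / 6"

lemma triple_bound_ge: "21 \<le> n \<Longrightarrow> 25270 \<le> triple_bound n"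
proof -
  assume n: "21 \<le> n"
  have "21 * 20 * 19\<^sup>2 / 6 \<le> real n * (real n - 1) * (real n - 2)\<^sup>2 / 6"
    using n by (intro divide_right_mono mult_mono power_mono) auto
  then show ?thesis by (simp add: triple_bound_def)
qed

lemmas choose_expand = binomial_gbinomial gbinomial_prod_rev atLeast0_lessThan_Suc numeral_eq_Suc

lemma real_choose_2: "real (N choose 2) = real N * (real N - 1) / 2"
  and real_choose_3: "real (N choose 3) = real N * (real N - 1) * (real N - 2) / 6"
  and real_choose_4: "real (N choose 4) = real N * (real N - 1) * (real N - 2) * (real N - 3) / 24"
  and real_choose_6: "real (N choose 6) =
      real N * (real N - 1) * (real N - 2) * (real N - 3) * (real N - 4) * (real N - 5) / 720"
  and real_choose_7: "real (N choose 7) =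
      real N * (real N - 1) * (real N - 2) * (real N - 3) * (real N - 4) * (real N - 5) * (real N - 6) / 5040"
  by (simp_all add: choose_expand)

text \<open>Expanded in powers of \<open>z\<close>, which is \<open>n\<close> minus 21, the
  difference has nonnegative coefficients; the next three estimates are proved likewise. Among the
  factors gained, the second summand pays for the deletions and the first is left to beat
  \<open>triple_bound n\<close>.\<close>

lemma choose_7_ge:
  assumes "21 \<le> n"
  shows "(12/10) * triple_bound n + 3 * real (n - 4) \<le> real ((n - 3) choose 7)"
proof -
  obtain k where k: "n = k + 21" using assms by (metis add.commute le_Suc_ex)
  define z where "z = real k"
  have r: "real (n - 3) = z + 18" "real (n - 4) = z + 17" "real n = z + 21" by (auto simp: k z_def)
  have "real ((n - 3) choose 7) - ((12/10) * triple_bound n + 3 * real (n - 4))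
      = 1449 + z * (313899/35 + z * (52059/20 + z * (29657/90 + z * (5527/240 + z * (673/720 + z * (1/48 + z * (1/5040)))))))"
    unfolding real_choose_7 triple_bound_def r by (simp add: field_simps power2_eq_square)
  also have "\<dots> \<ge> 0" by (intro add_nonneg_nonneg mult_nonneg_nonneg) (auto simp: z_def)
  finally show ?thesis by simp
qed

lemma choose_6_ge:
  assumes "21 \<le> n"
  shows "(7/10) * triple_bound n + 45 * real (n - 4) \<le> real ((n - 3) choose 6)"
proof -
  obtain k where k: "n = k + 21" using assms by (metis add.commute le_Suc_ex)
  define z where "z = real k"
  have r: "real (n - 3) = z + 18" "real (n - 4) = z + 17" "real n = z + 21" by (auto simp: k z_def)
  have "real ((n - 3) choose 6) - ((7/10) * triple_bound n + 45 * real (n - 4))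
      = 110 + z * (18207/5 + z * (82091/90 + z * (22433/240 + z * (3511/720 + z * (31/240 + z * (1/720))))))"
    unfolding real_choose_6 triple_bound_def r by (simp add: field_simps power2_eq_square)
  also have "\<dots> \<ge> 0" by (intro add_nonneg_nonneg mult_nonneg_nonneg) (auto simp: z_def)
  finally show ?thesis by simp
qed

lemma choose_4_ge:
  assumes "21 \<le> n"
  shows "(28/1000) * triple_bound n + 2 * real (\<Sum>i=1..<4. (n - 4) choose i) \<le> real ((n - 4) choose 4)"
proof -
  obtain k where k: "n = k + 21" using assms by (metis add.commute le_Suc_ex)
  define z where "z = real k"
  have r: "real (n - 4) = z + 17" "real n = z + 21" by (auto simp: k z_def)
  have "{1..<4} = {1, 2, 3::nat}" by auto
  then have "(\<Sum>i=1..<4. (n - 4) choose i) = (n - 4) + ((n - 4) choose 2) + ((n - 4) choose 3)" by simp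
  then have s: "real (\<Sum>i=1..<4. (n - 4) choose i)
      = (z + 17) + (z + 17) * (z + 17 - 1) / 2 + (z + 17) * (z + 17 - 1) * (z + 17 - 2) / 6"
    by (simp only: of_nat_add real_choose_2 real_choose_3 r)
  have "real ((n - 4) choose 4) - ((28/1000) * triple_bound n + 2 * real (\<Sum>i=1..<4. (n - 4) choose i))
      = 161/25 + z * (137399/750 + z * (32043/1000 + z * (1411/750 + z * (37/1000))))"
    unfolding real_choose_4 triple_bound_def r s by (simp add: field_simps power2_eq_square)
  also have "\<dots> \<ge> 0" by (intro add_nonneg_nonneg mult_nonneg_nonneg) (auto simp: z_def)
  finally show ?thesis by simp
qed

text \<open>\<open>W\<close> is cubic in \<open>n\<close> and \<open>triple_bound n\<close> quartic,
  so two factors of size about \<open>W\<close> are needed against it. The 11 comes from the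
  degree-12 binomial term used in \<open>gain_large\<close>.\<close>

lemma choose_3_ge:
  assumes "21 \<le> n"
  defines "W \<equiv> real ((n - 4) choose 3) - 3 * real (\<Sum>i=1..<3. (n - 4) choose i)"
  shows "221 \<le> W" "(17/10) * triple_bound n \<le> (W - 11)\<^sup>2"
proof -
  obtain k where k: "n = k + 21" using assms by (metis add.commute le_Suc_ex)
  define z where "z = real k"
  have r: "real (n - 4) = z + 17" "real n = z + 21" by (auto simp: k z_def)
  have "{1..<3} = {1, 2::nat}" by auto
  then have "(\<Sum>i=1..<3. (n - 4) choose i) = (n - 4) + ((n - 4) choose 2)" by simp
  then have s: "real (\<Sum>i=1..<3. (n - 4) choose i) = (z + 17) + (z + 17) * (z + 17 - 1) / 2"
    by (simp only: of_nat_add real_choose_2 r)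
  have W: "W = 221 + z * (226/3 + z * (13/2 + z * (1/6)))"
    unfolding W_def s real_choose_3 r by (simp add: field_simps)
  have "0 \<le> z * (226/3 + z * (13/2 + z * (1/6)))"
    by (intro add_nonneg_nonneg mult_nonneg_nonneg) (auto simp: z_def)
  then show "221 \<le> W" unfolding W by simp
  have "(W - 11)\<^sup>2 - (17/10) * triple_bound n
      = 1141 + z * (1375463/60 + z * (1393631/180 + z * (20539/20 + z * (6037/90 + z * (13/6 + z * (1/36))))))"
    unfolding W triple_bound_def r by (simp add: field_simps power2_eq_square)
  also have "\<dots> \<ge> 0" by (intro add_nonneg_nonneg mult_nonneg_nonneg) (auto simp: z_def)
  finally show "(17/10) * triple_bound n \<le> (W - 11)\<^sup>2" by simp
qed

section \<open>Gain against cost in four ranges of the density\<close>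

text \<open>The exponent 256 is \<open>2 ^ Suc 7\<close>. The target
  \<open>triple_bound n * \<delta>\<close> may lie far below or far above 1, so three terms of the
  expansion are used rather than a single one.\<close>

lemma gain_tiny:
  fixes \<delta> \<rho> :: real
  assumes n: "21 \<le> n" and \<delta>: "0 < \<delta>" "\<delta> \<le> 1/1000" and \<rho>: "(59/100) * \<delta> \<le> \<rho>"
  shows "triple_bound n * \<delta> * (1 + \<delta>) ^ (n - 4) < (1 + \<rho> * (1 - \<delta>) ^ 256) ^ ((n - 3) choose 7)"
proof -
  let ?M = "(n - 3) choose 7"
  \<comment> \<open>Bernoulli bounds \<open>(1 - \<delta>) ^ 256\<close> below by 744/1000, and
    43/100 is just under the product of 59/100 and 744/1000.\<close>
  define y where "y = (43/100) * \<delta>"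
  have "1 + real 256 * (- \<delta>) \<le> (1 + (- \<delta>)) ^ 256" using \<delta> by (intro Bernoulli_inequality) simp
  then have \<theta>: "(744/1000) \<le> (1 - \<delta>) ^ 256" using \<delta> by simp
  have "y \<le> (59/100) * \<delta> * (744/1000)" using \<delta> by (simp add: y_def)
  also have "\<dots> \<le> \<rho> * (1 - \<delta>) ^ 256" using \<theta> \<rho> \<delta> by (intro mult_mono) auto
  finally have yx: "y \<le> \<rho> * (1 - \<delta>) ^ 256" .
  have "1 + real 3 * y \<le> (1 + y) ^ 3" using \<delta> by (intro Bernoulli_inequality) (simp add: y_def)
  then have g: "1 + \<delta> \<le> (1 + y) ^ 3" using \<delta> by (simp add: y_def)
  have M: "(12/10) * triple_bound n + real (3 * (n - 4)) \<le> real ?M" using choose_7_ge[OF n] by simp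
  have tb: "25270 \<le> triple_bound n" by (rule triple_bound_ge[OF n])
  then have "real (3 * (n - 4)) \<le> real ?M" using M by linarith
  then have le: "3 * (n - 4) \<le> ?M" by (simp only: of_nat_le_iff)
  define W where "W = real (?M - 3 * (n - 4))"
  have W: "(12/10) * triple_bound n \<le> W" using M le by (simp add: W_def of_nat_diff)
  define u where "u = W * y"
  have u: "(516/1000) * (triple_bound n * \<delta>) \<le> u"
    using mult_right_mono[OF W, of y] \<delta> by (simp add: u_def y_def)
  have "(98/100) * u * u \<le> u * (u - y)"
  proof -
    have "(98/100) * W \<le> W - 1" using W tb by linarith
    then have "u * ((98/100) * W * y) \<le> u * ((W - 1) * y)"
      using \<delta> W tb by (intro mult_left_mono mult_right_mono) (auto simp: u_def y_def)
    then show ?thesis by (simp add: u_def algebra_simps)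
  qed
  moreover have "W * (W - 1) / 2 * y\<^sup>2 = u * (u - y) / 2" by (simp add: u_def field_simps power2_eq_square)
  ultimately have "1 + u + (49/100) * u\<^sup>2 \<le> 1 + W * y + W * (W - 1) / 2 * y\<^sup>2"
    by (simp add: u_def[symmetric] power2_eq_square)
  also have "\<dots> \<le> (1 + y) ^ (?M - 3 * (n - 4))"
    unfolding W_def using \<delta> by (intro quadratic_le_power) (simp add: y_def)
  finally have A: "1 + u + (49/100) * u\<^sup>2 \<le> (1 + y) ^ (?M - 3 * (n - 4))" .
  \<comment> \<open>Since \<open>u\<close> is at least 516/1000 of the target, it suffices to exceed
    \<open>(1938/1000) * u\<close>. This square has exactly the coefficients 49/100 and 938/1000,
    and its constant term is below 1.\<close>
  have "0 \<le> ((7/10) * u - (67/100))\<^sup>2" by simp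
  then have "(938/1000) * u < 1 + (49/100) * u\<^sup>2" by (simp add: power2_eq_square algebra_simps)
  moreover have "0 < triple_bound n * \<delta>" using tb \<delta> by simp
  ultimately have "triple_bound n * \<delta> < 1 + u + (49/100) * u\<^sup>2" using u by linarith
  then have "triple_bound n * \<delta> < (1 + y) ^ (?M - 3 * (n - 4))" using A by linarith
  then show ?thesis
    using \<delta> by (intro absorb_power[OF _ yx _ g le]) (auto simp: y_def)
qed

text \<open>On each of six subintervals \<delta> is replaced by the lower end in the first factor
  and by the upper end in the second; the decimal \<open>r\<close> below the 40th power keeps the
  numbers manageable. The exponent 640 is 5 * 128, from the fifth power in
  \<open>gain_small\<close>.\<close>

lemma small_product_bound:
  fixes \<delta> :: real
  assumes "1/1000 \<le> \<delta>" "\<delta> \<le> 1/40"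
  shows "1 < 40000000000000 * (\<delta> ^ 4 * (1 - \<delta>) ^ 640)"
proof -
  have step: "1 < 40000000000000 * (\<delta> ^ 4 * (1 - \<delta>) ^ 640)"
    if "1/l \<le> \<delta>" "\<delta> \<le> 1/u" "0 < l" "1 \<le> u" "0 \<le> r" "r \<le> (1 - 1/u) ^ 40"
      "1 < 40000000000000 * ((1/l) ^ 4 * r ^ 16)" for l u r :: real
  proof -
    have "r \<le> (1 - \<delta>) ^ 40"
      using that(2,4,6) by (intro order_trans[OF that(6)] power_mono) (auto simp: divide_le_eq)
    then have "(1/l) ^ 4 * r ^ 16 \<le> \<delta> ^ 4 * ((1 - \<delta>) ^ 40) ^ 16"
      using that(1,3,5) assms by (intro mult_mono power_mono) auto
    also have "((1 - \<delta>) ^ 40) ^ 16 = (1 - \<delta>) ^ 640" by (simp flip: power_mult)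
    finally show ?thesis using that(7) by linarith
  qed
  consider "1/1000 \<le> \<delta>" "\<delta> \<le> 1/250" | "1/250 \<le> \<delta>" "\<delta> \<le> 1/100" | "1/100 \<le> \<delta>" "\<delta> \<le> 1/60"
    | "1/60 \<le> \<delta>" "\<delta> \<le> 1/45" | "1/45 \<le> \<delta>" "\<delta> \<le> 1/42" | "1/42 \<le> \<delta>" "\<delta> \<le> 1/40"
    using assms by linarith
  then show ?thesis
  proof cases
    case 1
    then show ?thesis by (rule step[where r = "(85/100)"]) (simp_all add: power_divide)
  next
    case 2
    then show ?thesis by (rule step[where r = "(66/100)"]) (simp_all add: power_divide)
  next
    case 3
    then show ?thesis by (rule step[where r = "(5/10)"]) (simp_all add: power_divide)
  next
    case 4
    then show ?thesis by (rule step[where r = "(4/10)"]) (simp_all add: power_divide)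
  next
    case 5
    then show ?thesis by (rule step[where r = "(38/100)"]) (simp_all add: power_divide)
  next
    case 6
    then show ?thesis by (rule step[where r = "(362/1000)"]) (simp_all add: power_divide)
  qed
qed

text \<open>The exponent 128 is \<open>2 ^ Suc 6\<close>. The degree-5 term of
  \<open>(1 + y) ^ w\<close> suffices: its factor \<open>w\<close> is set against
  \<open>triple_bound n\<close>, one \<delta> from \<open>y ^ 5\<close> against the \<delta> of the
  target, and \<open>small_product_bound\<close> settles the rest.\<close>

lemma gain_small:
  fixes \<delta> \<rho> :: real
  assumes n: "21 \<le> n" and \<delta>: "1/1000 \<le> \<delta>" "\<delta> \<le> 1/40" and \<rho>: "(59/100) * \<delta> \<le> \<rho>"
  shows "triple_bound n * \<delta> * (1 + \<delta>) ^ (n - 4) < (1 + \<rho> * (1 - \<delta>) ^ 128) ^ ((n - 3) choose 6)"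
proof -
  let ?M = "(n - 3) choose 6"
  define y where "y = (59/100) * \<delta> * (1 - \<delta>) ^ 128"
  have y0: "0 \<le> y" using \<delta> by (simp add: y_def)
  have yx: "y \<le> \<rho> * (1 - \<delta>) ^ 128" unfolding y_def using \<rho> \<delta> by (intro mult_right_mono) auto
  \<comment> \<open>The eighth power of 666/1000 exceeds 1/26, and 45 * (59/100) exceeds 26; this is
    why 45 factors absorb one \<open>1 + \<delta>\<close>.\<close>
  have "(666/1000) \<le> (39/40 :: real) ^ 16" by (simp add: power_divide)
  also have "\<dots> \<le> (1 - \<delta>) ^ 16" using \<delta> by (intro power_mono) auto
  finally have "(666/1000) ^ 8 \<le> ((1 - \<delta>) ^ 16) ^ 8" by (intro power_mono) auto
  also have "\<dots> = (1 - \<delta>) ^ 128" by (simp flip: power_mult)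
  finally have "1 / 26 \<le> (1 - \<delta>) ^ 128" by (simp add: power_divide)
  then have "(59/100) * \<delta> * (1 / 26) \<le> y" unfolding y_def using \<delta> by (intro mult_left_mono) auto
  then have "\<delta> \<le> 45 * y" using \<delta> by simp
  moreover have "1 + real 45 * y \<le> (1 + y) ^ 45" using y0 by (intro Bernoulli_inequality) simp
  ultimately have g: "1 + \<delta> \<le> (1 + y) ^ 45" by simp
  have M: "(7/10) * triple_bound n + real (45 * (n - 4)) \<le> real ?M" using choose_6_ge[OF n] by simp
  have tb: "25270 \<le> triple_bound n" by (rule triple_bound_ge[OF n])
  then have "real (45 * (n - 4)) \<le> real ?M" using M by linarith
  then have le: "45 * (n - 4) \<le> ?M" by (simp only: of_nat_le_iff)
  define w where "w = ?M - 45 * (n - 4)"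
  have W: "(7/10) * triple_bound n \<le> real w" using M le by (simp add: w_def of_nat_diff)
  then have w4: "17685 \<le> real (w - 4)" using tb by (simp add: of_nat_diff)
  have "triple_bound n * \<delta> * 1 < triple_bound n * \<delta> * (40000000000000 * (\<delta> ^ 4 * (1 - \<delta>) ^ 640))"
    using tb \<delta> by (intro mult_strict_left_mono small_product_bound) auto
  also have "\<dots> = 40000000000000 * (triple_bound n * (\<delta> ^ 5 * (1 - \<delta>) ^ 640))"
    by (simp add: numeral_eq_Suc mult_ac)
  also have "\<dots> \<le> ((7/10) * 17685 ^ 4 / 120 * (59/100) ^ 5) * (triple_bound n * (\<delta> ^ 5 * (1 - \<delta>) ^ 640))"
    using tb \<delta> by (intro mult_right_mono) (auto simp: field_simps)
  also have "\<dots> = (7/10) * triple_bound n * 17685 ^ 4 / 120 * y ^ 5"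
    by (simp add: y_def power_mult_distrib power_mult[symmetric] field_simps)
  also have "\<dots> \<le> real w * real (w - 4) ^ 4 / 120 * y ^ 5"
    using W w4 tb y0 by (intro mult_right_mono divide_right_mono mult_mono power_mono) auto
  also have "\<dots> \<le> (1 + y) ^ w"
    using binomial_term_le_power[OF y0, of w 4] by (simp add: fact_numeral)
  finally have "triple_bound n * \<delta> < (1 + y) ^ (?M - 45 * (n - 4))" by (simp add: w_def)
  then show ?thesis
    using \<delta> by (intro absorb_power[OF y0 yx _ g le]) auto
qed

text \<open>The same scheme with the degree-8 term; 40320 is \<open>fact 8\<close>. The constant
  513/1000 is just under 59/115, as \<open>1 + \<delta>\<close> is at most 115/100.\<close>

lemma gain_medium:
  fixes \<delta> \<rho> :: real
  assumes n: "21 \<le> n" and \<delta>: "1/40 \<le> \<delta>" "\<delta> \<le> (15/100)" and \<rho>: "(59/100) * \<delta> \<le> \<rho>"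
  shows "triple_bound n * \<delta> * (1 + \<delta>) ^ (\<Sum>i=1..<4. (n - 4) choose i)
    < (1 + \<rho> / (1 + \<delta>)) ^ ((n - 4) choose 4)"
proof -
  let ?M = "(n - 4) choose 4" and ?q = "\<Sum>i=1..<4. (n - 4) choose i"
  define y where "y = (513/1000) * \<delta>"
  have y0: "0 \<le> y" using \<delta> by (simp add: y_def)
  have "y * (1 + \<delta>) \<le> y * (115/100)" using \<delta> y0 by (intro mult_left_mono) auto
  also have "\<dots> \<le> \<rho>" using \<rho> \<delta> by (simp add: y_def)
  finally have yx: "y \<le> \<rho> / (1 + \<delta>)" using \<delta> by (simp add: pos_le_divide_eq)
  have "1 + real 2 * y \<le> (1 + y) ^ 2" using y0 by (intro Bernoulli_inequality) simp
  then have g: "1 + \<delta> \<le> (1 + y) ^ 2" using \<delta> by (simp add: y_def)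
  have M: "(28/1000) * triple_bound n + real (2 * ?q) \<le> real ?M" using choose_4_ge[OF n] by simp
  have tb: "25270 \<le> triple_bound n" by (rule triple_bound_ge[OF n])
  then have "real (2 * ?q) \<le> real ?M" using M by linarith
  then have le: "2 * ?q \<le> ?M" by (simp only: of_nat_le_iff)
  define w where "w = ?M - 2 * ?q"
  have W: "(28/1000) * triple_bound n \<le> real w" using M le by (simp add: w_def of_nat_diff)
  then have w7: "700 \<le> real (w - 7)" using tb by (simp add: of_nat_diff)
  have "(1/40) ^ 7 \<le> \<delta> ^ 7" using \<delta> by (intro power_mono) auto
  then have "1 < ((28/1000) * 700 ^ 7 / 40320 * (513/1000) ^ 8) * \<delta> ^ 7" by (simp add: power_divide)
  then have "triple_bound n * \<delta> * 1 < triple_bound n * \<delta> * (((28/1000) * 700 ^ 7 / 40320 * (513/1000) ^ 8) * \<delta> ^ 7)"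
    using tb \<delta> by (intro mult_strict_left_mono) auto
  also have "\<dots> = (28/1000) * triple_bound n * 700 ^ 7 / 40320 * y ^ 8"
  proof -
    have "y ^ 8 = (513/1000) ^ 8 * (\<delta> * \<delta> ^ 7)"
      unfolding y_def power_mult_distrib using power_Suc[of \<delta> 7] by simp
    then show ?thesis by simp
  qed
  also have "\<dots> \<le> real w * real (w - 7) ^ 7 / 40320 * y ^ 8"
    using W w7 tb y0 by (intro mult_right_mono divide_right_mono mult_mono power_mono) auto
  also have "\<dots> \<le> (1 + y) ^ w"
    using binomial_term_le_power[OF y0, of w 7] by (simp add: fact_numeral)
  finally have "triple_bound n * \<delta> < (1 + y) ^ (?M - 2 * ?q)" by (simp add: w_def)
  then show ?thesis
    using \<delta> by (intro absorb_power[OF y0 yx _ g le]) auto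
qed

text \<open>The target carries no \<delta>, since for dense families the star count is bounded by
  the first stage count alone. In the degree-12 term (479001600 is \<open>fact 12\<close>) two
  factors are set against \<open>triple_bound n\<close> by \<open>choose_3_ge\<close>.\<close>

lemma gain_large:
  fixes \<delta> \<rho> :: real
  assumes n: "21 \<le> n" and \<delta>: "(15/100) \<le> \<delta>" "\<delta> \<le> 1" and \<rho>: "(59/100) * \<delta> \<le> \<rho>"
  shows "triple_bound n * (1 + \<delta>) ^ (\<Sum>i=1..<3. (n - 4) choose i)
    < (1 + \<rho> / (1 + \<delta>)) ^ ((n - 4) choose 3)"
proof -
  let ?M = "(n - 4) choose 3" and ?q = "\<Sum>i=1..<3. (n - 4) choose i"
  define y where "y = (59/100) * \<delta> / (1 + \<delta>)"
  have y: "(769/10000) \<le> y" using \<delta> by (simp add: y_def pos_le_divide_eq)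
  then have y0: "0 \<le> y" by simp
  have yx: "y \<le> \<rho> / (1 + \<delta>)" unfolding y_def using \<rho> \<delta> by (intro divide_right_mono) auto
  have g: "1 + \<delta> \<le> (1 + y) ^ 3"
  proof -
    have y': "y * (1 + \<delta>) = (59/100) * \<delta>" 
      by (rule nonzero_eq_divide_eq[THEN iffD1, OF _ y_def]) (use \<delta> in simp)
    have "\<delta> * \<delta> \<le> \<delta>" using \<delta> by (simp add: mult_left_le)
    moreover have "(1 + \<delta>) * (1 + \<delta>) = 1 + 2 * \<delta> + \<delta> * \<delta>" by (simp add: algebra_simps)
    \<comment> \<open>This is \<open>\<delta> \<le> 3 * y + 3 * y\<^sup>2\<close> multiplied by
      \<open>(1 + \<delta>)\<^sup>2 / \<delta>\<close>: 177/100 is three times 59/100, and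
      10443/10000 three times its square.\<close>
    ultimately have "(1 + \<delta>) * (1 + \<delta>) \<le> (177/100) * (1 + \<delta>) + (10443/10000) * \<delta>"
      using \<delta> unfolding distrib_left by linarith
    then have "\<delta> * (1 + \<delta>) * (1 + \<delta>) \<le> \<delta> * ((177/100) * (1 + \<delta>) + (10443/10000) * \<delta>)"
      using \<delta> by (subst mult.assoc, intro mult_left_mono) auto
    also have "\<dots> = (3 * y + 3 * y\<^sup>2) * (1 + \<delta>) * (1 + \<delta>)"
    proof -
      have "(3 * y + 3 * y\<^sup>2) * (1 + \<delta>) * (1 + \<delta>) = 3 * (y * (1 + \<delta>)) * (1 + \<delta>) + 3 * (y * (1 + \<delta>))\<^sup>2"
        by (simp add: algebra_simps power2_eq_square)
      then show ?thesis unfolding y' by (simp add: algebra_simps power2_eq_square)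
    qed
    finally have "\<delta> \<le> 3 * y + 3 * y\<^sup>2" using \<delta> by simp
    moreover have "(1 + y) ^ 3 = 1 + 3 * y + 3 * y\<^sup>2 + y ^ 3"
      by (simp add: power3_eq_cube power2_eq_square algebra_simps)
    ultimately show ?thesis using y0 zero_le_power[OF y0, of 3] by linarith
  qed
  note W = choose_3_ge[OF n]
  have tb: "25270 \<le> triple_bound n" by (rule triple_bound_ge[OF n])
  have "real (3 * ?q) \<le> real ?M" using W(1) by simp
  then have le: "3 * ?q \<le> ?M" by (simp only: of_nat_le_iff)
  define w where "w = ?M - 3 * ?q"
  have w: "real w = real ?M - 3 * real ?q" using le by (simp add: w_def of_nat_diff)
  then have w11: "real (w - 11) = real w - 11" using W(1) by (simp add: of_nat_diff)
  have w210: "210 \<le> real (w - 11)" using w w11 W(1) by simp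
  have "triple_bound n * 1 < triple_bound n * ((17/10) * 210 ^ 10 / 479001600 * (769/10000) ^ 12)"
    using tb by (intro mult_strict_left_mono) (simp_all add: power_divide)
  also have "\<dots> = ((17/10) * triple_bound n) * (210 ^ 10 / 479001600 * (769/10000) ^ 12)" by simp
  also have "\<dots> \<le> (real (w - 11))\<^sup>2 * (210 ^ 10 / 479001600 * (769/10000) ^ 12)"
    using W(2) w w11 by (intro mult_right_mono) auto
  also have "\<dots> \<le> (real w * real (w - 11)) * (real (w - 11) ^ 10 / 479001600 * y ^ 12)"
    unfolding power2_eq_square
    using w210 y by (intro mult_mono divide_right_mono power_mono) auto
  also have "\<dots> = real w * real (w - 11) ^ 11 / 479001600 * y ^ 12"
    using power_Suc[of "real (w - 11)" 10] by simp
  also have "\<dots> \<le> (1 + y) ^ w"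
    using binomial_term_le_power[OF y0, of w 11] by (simp add: fact_numeral)
  finally have "triple_bound n < (1 + y) ^ (?M - 3 * ?q)" by (simp add: w_def)
  then show ?thesis
    using \<delta> by (intro absorb_power[OF y0 yx _ g le]) auto
qed

section \<open>Families through a triple of 2-sets\<close>

lemma intersecting_common: "(\<And>F. F \<in> \<F> \<Longrightarrow> x \<in> F) \<Longrightarrow> intersecting \<F>"
  unfolding intersecting_def by blast

lemma intersectingD: "intersecting \<F> \<Longrightarrow> A \<in> \<F> \<Longrightarrow> B \<in> \<F> \<Longrightarrow> A \<inter> B \<noteq> {}"
  unfolding intersecting_def by blast

lemma int_families_0: "finite \<A> \<Longrightarrow> int_families 0 \<A> = {{}}"
  using finite_subset by (fastforce simp: int_families_def intersecting_def)

context star_config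
begin

text \<open>As \<delta> grows, the route changes from \<open>sparse_gain\<close> with
  \<open>r\<close> equal to 7, then 6, to \<open>level_gain\<close> with \<open>r\<close> equal to
  4, then 3. Up to 15/100 the bound \<open>A \<le> \<delta> * S\<close> is used, beyond it
  \<open>A \<le> S\<close>.\<close>

lemma pair_beats_star:
  assumes pos: "0 < nisf J star_compatible"
  shows "triple_bound n * nisf J star_compatible < nisf (Suc J) pair_compatible"
proof -
  define p :: real where "p = 2 ^ (n - 3)"
  define \<delta> where "\<delta> = real (Suc J) / real (card bath + 1)"
  define \<rho> where "\<rho> = real (Suc J) / (5 * p)"
  define A S B where "A = real (nisf J star_compatible)" and "S = real (nisf (Suc J) (stage {} {}))"
    and "B = real (nisf (Suc J) pair_compatible)"
  have "(2::real) ^ 18 \<le> p" unfolding p_def using n by (intro power_increasing) auto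
  then have p: "262144 \<le> p" by simp
  have "(1::nat) \<le> 3 * 2 ^ (n - 3)" by simp
  then have bath: "real (card bath + 1) = 3 * p - 1" unfolding card_bath p_def by (simp add: of_nat_diff)
  have \<delta>: "0 < \<delta>" "real (Suc J) \<le> \<delta> * real (card bath + 1)" using p by (auto simp: \<delta>_def bath)
  have \<rho>: "0 < \<rho>" "\<rho> * (5 * 2 ^ (n - 3)) \<le> real (Suc J)" using p by (auto simp: \<rho>_def p_def)
  have \<rho>\<delta>: "(59/100) * \<delta> \<le> \<rho>"
  proof -
    \<comment> \<open>The slack between 59/100 and 3/5 covers the \<open>- 1\<close>, as
      \<open>p\<close> is large.\<close>
    have "(59/100) / (3 * p - 1) \<le> 1 / (5 * p)" using p by (simp add: field_simps)
    then have "real (Suc J) * ((59/100) / (3 * p - 1)) \<le> real (Suc J) * (1 / (5 * p))"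
      by (rule mult_left_mono) simp
    then show ?thesis unfolding \<delta>_def \<rho>_def bath by (simp add: mult.commute)
  qed
  have A: "0 < A" "A \<le> S" "A \<le> \<delta> * S"
  proof -
    show "0 < A" using pos by (simp add: A_def)
    show "A \<le> S" using start_gain(2) by (simp add: A_def S_def)
    have "real (card bath + 1) * A \<le> real (Suc J) * S" using start_gain(1) by (simp only: A_def S_def)
    then show "A \<le> \<delta> * S" using p by (simp add: \<delta>_def bath field_simps)
  qed
  then have S: "0 < S" by linarith
  \<comment> \<open>Here \<open>t\<close> bounds \<open>A / S\<close>, \<open>f\<close> is the gain
    from admitting sets and \<open>g\<close> the cost of deletions.\<close>
  have B: "triple_bound n * A < B"
    if "triple_bound n * t * g < f" "f * S \<le> g * B" "A \<le> t * S" "0 < g" for f g t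
  proof -
    have "g * (triple_bound n * A) \<le> g * (triple_bound n * (t * S))"
      using that triple_bound_ge[OF n] by (intro mult_left_mono) auto
    also have "\<dots> = (triple_bound n * t * g) * S" by simp
    also have "\<dots> < f * S" using that S by (intro mult_strict_right_mono) auto
    also have "\<dots> \<le> g * B" by (rule that)
    finally show ?thesis using that by simp
  qed
  consider "\<delta> \<le> 1/1000" | "1/1000 \<le> \<delta>" "\<delta> \<le> 1/40" | "1/40 \<le> \<delta>" "\<delta> \<le> (15/100)" | "(15/100) \<le> \<delta>"
    by linarith
  then have "triple_bound n * A < B"
  proof cases
    case 1
    have "(1 + \<rho> * (1 - \<delta>) ^ 256) ^ ((n - 3) choose 7) * S \<le> (1 + \<delta>) ^ (n - 4) * B"
      using sparse_gain[of 7 J \<delta> \<rho>] 1 \<delta> \<rho> by (simp add: S_def B_def)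
    from B[OF gain_tiny[OF n \<delta>(1) 1 \<rho>\<delta>] this A(3)] show ?thesis using \<delta> by simp
  next
    case 2
    have "(1 + \<rho> * (1 - \<delta>) ^ 128) ^ ((n - 3) choose 6) * S \<le> (1 + \<delta>) ^ (n - 4) * B"
      using sparse_gain[of 6 J \<delta> \<rho>] 2 \<delta> \<rho> by (simp add: S_def B_def)
    from B[OF gain_small[OF n 2 \<rho>\<delta>] this A(3)] show ?thesis using \<delta> by simp
  next
    case 3
    have "(1 + \<rho> / (1 + \<delta>)) ^ ((n - 4) choose 4) * S \<le> (1 + \<delta>) ^ (\<Sum>i=1..<4. (n - 4) choose i) * B"
      using level_gain[of 4 J \<delta> \<rho>] 3 \<delta> \<rho> by (simp add: S_def B_def min_absorb1)
    from B[OF gain_medium[OF n 3 \<rho>\<delta>] this A(3)] show ?thesis using \<delta> by simp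
  next
    case 4
    let ?d = "min \<delta> 1"
    have d: "(15/100) \<le> ?d" "?d \<le> 1" "(59/100) * ?d \<le> \<rho>" using 4 \<rho>\<delta> by auto
    have "(1 + \<rho> / (1 + ?d)) ^ ((n - 4) choose 3) * S \<le> (1 + ?d) ^ (\<Sum>i=1..<3. (n - 4) choose i) * B"
      using level_gain[of 3 J \<delta> \<rho>] \<delta> \<rho> by (simp add: S_def B_def)
    then show ?thesis by (rule B[where t = 1, rotated]) (use gain_large[OF n d] A d in auto)
  qed
  then show ?thesis by (simp add: A_def B_def)
qed

text \<open>All sets through \<open>v\<close> except \<open>{v}\<close> and the three edges,
  together with the complement of \<open>{v}\<close>, form an intersecting system of compatible
  sets, so each choice of \<open>J\<close> of them counts. That complement makes the number agree
  exactly with the bound for triangles.\<close>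

lemma binomial_le_star: "(2 ^ (n - 1) - 3) choose J \<le> nisf J star_compatible"
proof -
  let ?T = "{Z. Z \<subseteq> {1..n} \<and> Z \<inter> {v} \<in> {{v}}}" and ?E = "{{v}, {v, a}, {v, b}, {v, c}}"
  let ?S = "insert ({1..n} - {v}) (?T - ?E)"
  have fT: "finite ?T" by (rule finite_subset[of _ "Pow {1..n}"]) auto
  have T: "card ?T = 2 ^ (n - 1)"
    using in_ground by (subst card_subsets_trace) auto
  have E: "?E \<subseteq> ?T" using in_ground by auto
  have "card ?E = 4" using distinct by (auto simp: card_insert_if doubleton_eq_iff)
  then have "card (?T - ?E) = 2 ^ (n - 1) - 4" using T E by (subst card_Diff_subset) auto
  moreover have "(2::nat) ^ 2 \<le> 2 ^ (n - 1)" using n by (intro power_increasing) auto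
  ultimately have card: "card ?S = 2 ^ (n - 1) - 3" using fT by (subst card_insert_disjoint) auto
  have "intersecting ?S"
  proof -
    have "{1..n} - {v} \<noteq> {}" using in_ground distinct by auto
    moreover have "Z \<inter> ({1..n} - {v}) \<noteq> {}" if "Z \<in> ?T - ?E" for Z
    proof -
      have "Z \<subseteq> {1..n}" "v \<in> Z" "Z \<noteq> {v}" using that by auto
      then show ?thesis by blast
    qed
    moreover have "intersecting (?T - ?E)"
      by (rule intersecting_common[where x = v]) auto
    ultimately show ?thesis unfolding intersecting_insert by blast
  qed
  then have eq: "int_families J ?S = {\<F>. \<F> \<subseteq> ?S \<and> card \<F> = J}"
    by (auto simp: int_families_def intro: intersecting_subset)
  have "finite ?S" using fT by simp
  then have "card (int_families J ?S) = card ?S choose J"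
    unfolding eq by (rule n_subsets)
  then have "card (int_families J ?S) = (2 ^ (n - 1) - 3) choose J"
    by (simp only: card)
  moreover have "?S \<subseteq> star_compatible"
  proof
    fix Z assume "Z \<in> ?S"
    then consider "Z = {1..n} - {v}" | "Z \<in> ?T - ?E" by blast
    then show "Z \<in> star_compatible"
    proof cases
      case 1
      then have "card Z = n - 1" "Z \<subseteq> {1..n}" using in_ground by simp_all
      moreover have "v \<notin> Z" "{a, b, c} \<subseteq> Z" using 1 in_ground distinct by simp_all
      moreover from this have "Z \<notin> {{v, a}, {v, b}, {v, c}}" by blast
      ultimately show ?thesis using n by (simp add: star_compatible_def)
    next
      case 2
      then have Z: "Z \<subseteq> {1..n}" "v \<in> Z" "Z \<notin> ?E" by auto
      then obtain y where y: "{v, y} \<subseteq> Z" "y \<noteq> v" by blast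
      have "card {v, y} \<le> card Z" using finite_subset[OF Z(1)] y(1) by (intro card_mono) auto
      then have "2 \<le> card Z" using y(2) by simp
      then show ?thesis using Z by (simp add: star_compatible_def)
    qed
  qed
  ultimately show ?thesis
    using nisf_mono[OF finite_star_compatible, of ?S J] by (simp add: nisf_card)
qed

end

section \<open>Families with prescribed 2-sets and their symmetry\<close>

text \<open>Taken inside \<open>upper_layers n 2\<close>, so that the count depends on
  \<open>S\<close> alone and not on the family \<B> under study.\<close>

definition families_with_edges :: "nat \<Rightarrow> nat \<Rightarrow> nat set set \<Rightarrow> nat set set set" where
  "families_with_edges n s S = {\<F> \<in> int_families s (upper_layers n 2). \<F> \<inter> layer n 2 = S}"

lemma finite_layer: "finite (layer n r)"
  by (rule finite_subset[of _ "Pow {1..n}"]) (auto simp: layer_def)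

lemma finite_upper_layers: "finite (upper_layers n r)"
  by (rule finite_subset[of _ "Pow {1..n}"]) (auto simp: upper_layers_def)

lemma upper_layers_2: "upper_layers n 2 = upper_layers n 3 \<union> layer n 2"
  by (auto simp: upper_layers_def layer_def)

lemma upper_layers_disjoint: "upper_layers n 3 \<inter> layer n 2 = {}"
  by (auto simp: upper_layers_def layer_def)

lemma finite_families_with_edges: "finite (families_with_edges n s S)"
  unfolding families_with_edges_def by (simp add: finite_int_families finite_upper_layers)

text \<open>A permutation of the ground set acts injectively on families and respects sizes and
  intersections. One inequality is enough, as it is applied in both directions.\<close>

lemma card_families_with_edges_le:
  assumes \<pi>: "bij_betw \<pi> {1..n} {1..n}"
  shows "card (families_with_edges n s S) \<le> card (families_with_edges n s ((`) \<pi> ` S))"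
proof (rule card_inj_on_le[of "(`) ((`) \<pi>)"])
  have inj: "inj_on \<pi> {1..n}" using \<pi> by (rule bij_betw_imp_inj_on)
  have inj2: "inj_on ((`) \<pi>) (Pow {1..n})" by (rule inj_on_image_Pow[OF inj])
  have "inj_on ((`) ((`) \<pi>)) (Pow (Pow {1..n}))" by (rule inj_on_image_Pow[OF inj2])
  then show "inj_on ((`) ((`) \<pi>)) (families_with_edges n s S)"
    by (rule inj_on_subset) (auto simp: families_with_edges_def int_families_def upper_layers_def)
  show "(`) ((`) \<pi>) ` families_with_edges n s S \<subseteq> families_with_edges n s ((`) \<pi> ` S)"
  proof clarify
    fix \<F> assume F: "\<F> \<in> families_with_edges n s S"
    then have sub: "\<F> \<subseteq> Pow {1..n}"
      by (auto simp: families_with_edges_def int_families_def upper_layers_def)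
    have c: "card (\<pi> ` X) = card X" "\<pi> ` X \<subseteq> {1..n}" if "X \<in> \<F>" for X
    proof -
      have "X \<subseteq> {1..n}" using that sub by auto
      then show "card (\<pi> ` X) = card X" "\<pi> ` X \<subseteq> {1..n}"
        using card_image[OF inj_on_subset[OF inj]] bij_betw_imp_surj_on[OF \<pi>] by auto
    qed
    have "card ((`) \<pi> ` \<F>) = card \<F>" by (rule card_image[OF inj_on_subset[OF inj2 sub]])
    moreover have "intersecting ((`) \<pi> ` \<F>)"
    proof -
      have "intersecting \<F>" using F by (simp add: families_with_edges_def int_families_def)
      then show ?thesis unfolding intersecting_def by blast
    qed
    moreover have "(`) \<pi> ` \<F> \<subseteq> upper_layers n 2"
      using F c by (force simp: families_with_edges_def int_families_def upper_layers_def)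
    moreover have "((`) \<pi> ` \<F>) \<inter> layer n 2 = (`) \<pi> ` (\<F> \<inter> layer n 2)"
    proof -
      have "\<pi> ` X \<in> layer n 2 \<longleftrightarrow> X \<in> layer n 2" if "X \<in> \<F>" for X
        using c[OF that] that sub by (auto simp: layer_def)
      then show ?thesis by blast
    qed
    ultimately show "(`) \<pi> ` \<F> \<in> families_with_edges n s ((`) \<pi> ` S)"
      using F by (simp add: families_with_edges_def int_families_def)
  qed
qed (rule finite_families_with_edges)

lemma extend_to_permutation:
  assumes "finite S" "K \<subseteq> S" "inj_on f K" "f ` K \<subseteq> S"
  obtains \<pi> where "bij_betw \<pi> S S" "\<And>x. x \<in> K \<Longrightarrow> \<pi> x = f x"
proof -
  have fin: "finite K" using assms finite_subset by auto
  have "card (S - K) = card (S - f ` K)"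
    using assms fin by (simp add: card_Diff_subset card_image)
  then obtain g where g: "bij_betw g (S - K) (S - f ` K)"
    using finite_same_card_bij[of "S - K" "S - f ` K"] assms(1) by auto
  let ?\<pi> = "\<lambda>x. if x \<in> K then f x else g x"
  have "bij_betw ?\<pi> K (f ` K)"
    using bij_betw_cong[of K ?\<pi> f] inj_on_imp_bij_betw[OF assms(3)] by simp
  moreover have "bij_betw ?\<pi> (S - K) (S - f ` K)"
    using bij_betw_cong[of "S - K" ?\<pi> g] g by simp
  ultimately have "bij_betw ?\<pi> (K \<union> (S - K)) (f ` K \<union> (S - f ` K))"
    by (rule bij_betw_combine) auto
  moreover have "K \<union> (S - K) = S" "f ` K \<union> (S - f ` K) = S" using assms by auto
  ultimately have "bij_betw ?\<pi> S S" by simp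
  then show ?thesis using that[of ?\<pi>] by simp
qed

lemma card_families_with_edges_pair_le:
  assumes "{v, a, b} \<subseteq> {1..n}" "v \<noteq> a" "v \<noteq> b" "a \<noteq> b"
    and "{v', a', b'} \<subseteq> {1..n}" "v' \<noteq> a'" "v' \<noteq> b'" "a' \<noteq> b'"
  shows "card (families_with_edges n s {{v, a}}) \<le> card (families_with_edges n s {{v', a'}})"
    and "card (families_with_edges n s {{v, a}, {v, b}}) \<le> card (families_with_edges n s {{v', a'}, {v', b'}})"
proof -
  let ?f = "\<lambda>x. if x = v then v' else if x = a then a' else b'"
  have "inj_on ?f {v, a, b}" using assms by (auto simp: inj_on_def)
  moreover have "?f ` {v, a, b} \<subseteq> {1..n}" using assms by auto
  ultimately obtain \<pi> where \<pi>: "bij_betw \<pi> {1..n} {1..n}" "\<And>x. x \<in> {v, a, b} \<Longrightarrow> \<pi> x = ?f x"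
    using extend_to_permutation[of "{1..n}" "{v, a, b}" ?f] assms(1) by blast
  have "\<pi> v = v'" "\<pi> a = a'" "\<pi> b = b'" using \<pi>(2) assms by auto
  then show "card (families_with_edges n s {{v, a}}) \<le> card (families_with_edges n s {{v', a'}})"
    and "card (families_with_edges n s {{v, a}, {v, b}}) \<le> card (families_with_edges n s {{v', a'}, {v', b'}})"
    using card_families_with_edges_le[OF \<pi>(1), of s "{{v, a}}"]
      card_families_with_edges_le[OF \<pi>(1), of s "{{v, a}, {v, b}}"] by simp_all
qed

lemma layer_2_cases:
  assumes "e \<in> layer n 2"
  obtains x y where "e = {x, y}" "x \<noteq> y" "x \<in> {1..n}" "y \<in> {1..n}"
  using assms unfolding layer_def by (auto simp: card_2_iff)

lemma layer_2_meeting_cases: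
  assumes "e \<in> layer n 2" "e' \<in> layer n 2" "e \<noteq> e'" "e \<inter> e' \<noteq> {}"
  obtains v a b where "e = {v, a}" "e' = {v, b}" "v \<noteq> a" "v \<noteq> b" "a \<noteq> b" "{v, a, b} \<subseteq> {1..n}"
proof -
  obtain x y where xy: "e = {x, y}" "x \<noteq> y" "x \<in> {1..n}" "y \<in> {1..n}" using layer_2_cases[OF assms(1)] .
  obtain z w where zw: "e' = {z, w}" "z \<noteq> w" "z \<in> {1..n}" "w \<in> {1..n}" using layer_2_cases[OF assms(2)] .
  consider "x = z" | "x = w" | "y = z" | "y = w" using assms(4) xy zw by auto
  then show ?thesis
  proof cases
    case 1 then show ?thesis using that[of x y w] xy zw assms(3) by auto
  next
    case 2 then show ?thesis using that[of x y z] xy zw assms(3) by auto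
  next
    case 3 then show ?thesis using that[of y x w] xy zw assms(3) by auto
  next
    case 4 then show ?thesis using that[of y x z] xy zw assms(3) by auto
  qed
qed

section \<open>Stars and triangles of 2-sets\<close>

text \<open>Stars, indexed by centre and leaves, followed by triangles, indexed by their
  vertices.\<close>

definition triple_configs :: "nat \<Rightarrow> nat set set set" where
  "triple_configs n =
    (\<lambda>(v, Y). (\<lambda>y. {v, y}) ` Y) ` (SIGMA v:{1..n}. {Y. Y \<subseteq> {1..n} - {v} \<and> card Y = 3})
    \<union> (\<lambda>Y. {e. e \<subseteq> Y \<and> card e = 2}) ` {Y. Y \<subseteq> {1..n} \<and> card Y = 3}"

lemma finite_triple_configs: "finite (triple_configs n)"
  unfolding triple_configs_def by (intro finite_UnI finite_imageI finite_SigmaI) auto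

lemma card_triple_configs:
  assumes "21 \<le> n"
  shows "real (card (triple_configs n)) \<le> triple_bound n"
proof -
  let ?A = "SIGMA v:{1..n}. {Y. Y \<subseteq> {1..n} - {v} \<and> card Y = 3}" and ?B = "{Y. Y \<subseteq> {1..n} \<and> card Y = 3}"
  have fin: "finite ?A" "finite ?B" by (auto intro!: finite_SigmaI)
  have "card ?A = (\<Sum>v\<in>{1..n}. card {Y. Y \<subseteq> {1..n} - {v} \<and> card Y = 3})"
    by (intro card_SigmaI) auto
  also have "\<dots> = (\<Sum>v\<in>{1..n}. (n - 1) choose 3)" by (intro sum.cong) (auto simp: n_subsets)
  finally have A: "card ?A = n * ((n - 1) choose 3)" by simp
  have B: "card ?B = n choose 3" by (simp add: n_subsets)
  have "card (triple_configs n) \<le> card ?A + card ?B"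
    unfolding triple_configs_def by (intro order_trans[OF card_Un_le] add_mono card_image_le fin)
  then have "real (card (triple_configs n)) \<le> real n * real ((n - 1) choose 3) + real (n choose 3)"
    unfolding A B by (metis of_nat_add of_nat_le_iff of_nat_mult)
  also have "\<dots> = triple_bound n"
    using assms unfolding real_choose_3 triple_bound_def
    by (simp add: of_nat_diff field_simps power2_eq_square)
  finally show ?thesis .
qed

lemma triple_configs_cases:
  assumes "T \<in> triple_configs n"
  obtains v a b c where "T = {{v, a}, {v, b}, {v, c}}" "{v, a, b, c} \<subseteq> {1..n}"
      "v \<noteq> a" "v \<noteq> b" "v \<noteq> c" "a \<noteq> b" "a \<noteq> c" "b \<noteq> c"
    | a b c where "T = {{a, b}, {a, c}, {b, c}}" "{a, b, c} \<subseteq> {1..n}" "a \<noteq> b" "a \<noteq> c" "b \<noteq> c"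
proof -
  consider v Y where "T = (\<lambda>y. {v, y}) ` Y" "v \<in> {1..n}" "Y \<subseteq> {1..n} - {v}" "card Y = 3"
    | Y where "T = {e. e \<subseteq> Y \<and> card e = 2}" "Y \<subseteq> {1..n}" "card Y = 3"
    using assms unfolding triple_configs_def by auto
  then show ?thesis
  proof cases
    case 1
    obtain a b c where "Y = {a, b, c}" "a \<noteq> b" "b \<noteq> c" "a \<noteq> c" using 1(4) by (auto simp: card_3_iff)
    then show ?thesis using 1 by (intro that(1)[of v a b c]) auto
  next
    case 2
    obtain a b c where Y: "Y = {a, b, c}" "a \<noteq> b" "b \<noteq> c" "a \<noteq> c" using 2(3) by (auto simp: card_3_iff)
    have "T = {{a, b}, {a, c}, {b, c}}"
    proof
      show "T \<subseteq> {{a, b}, {a, c}, {b, c}}"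
      proof
        fix e assume "e \<in> T"
        then have "e \<subseteq> Y" "card e = 2" using 2(1) by auto
        then obtain x y where "e = {x, y}" "x \<noteq> y" "x \<in> Y" "y \<in> Y" by (auto simp: card_2_iff)
        then show "e \<in> {{a, b}, {a, c}, {b, c}}" using Y by auto
      qed
    qed (use 2 Y in auto)
    then show ?thesis using 2 Y by (intro that(2)[of a b c]) auto
  qed
qed

text \<open>Choose three of the 2-sets. If the third avoids the common point of the first two, it
  must join their other ends and close a triangle.\<close>

lemma contains_triple_config:
  assumes S: "S \<subseteq> layer n 2" "intersecting S" "3 \<le> card S"
  obtains T where "T \<in> triple_configs n" "T \<subseteq> S"
proof -
  obtain S' where "S' \<subseteq> S" "card S' = 3" using obtain_subset_with_card_n[OF S(3)] by auto
  then obtain e1 e2 e3 where e: "{e1, e2, e3} \<subseteq> S" "e1 \<noteq> e2" "e2 \<noteq> e3" "e1 \<noteq> e3"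
    by (auto simp: card_3_iff)
  then have L: "e1 \<in> layer n 2" "e2 \<in> layer n 2" "e3 \<in> layer n 2"
    and I: "e1 \<inter> e2 \<noteq> {}" "e1 \<inter> e3 \<noteq> {}" "e2 \<inter> e3 \<noteq> {}"
    using S by (auto simp: intersecting_def)
  obtain v a b where vab: "e1 = {v, a}" "e2 = {v, b}" "v \<noteq> a" "v \<noteq> b" "a \<noteq> b" "{v, a, b} \<subseteq> {1..n}"
    using layer_2_meeting_cases[OF L(1,2) e(2) I(1)] .
  obtain x y where xy: "e3 = {x, y}" "x \<noteq> y" "x \<in> {1..n}" "y \<in> {1..n}" using layer_2_cases[OF L(3)] .
  show ?thesis
  proof (cases "v \<in> e3")
    case True
    then obtain c where c: "e3 = {v, c}" "c \<noteq> v" "c \<in> {1..n}" using xy by auto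
    have "a \<noteq> c" "b \<noteq> c" using e vab c by auto
    then have "(v, {a, b, c}) \<in> (SIGMA v:{1..n}. {Y. Y \<subseteq> {1..n} - {v} \<and> card Y = 3})"
      using vab c by simp
    from imageI[OF this, of "\<lambda>(v, Y). (\<lambda>y. {v, y}) ` Y"]
    have "(\<lambda>y. {v, y}) ` {a, b, c} \<in> triple_configs n"
      unfolding triple_configs_def prod.case by (rule UnI1)
    moreover have "(\<lambda>y. {v, y}) ` {a, b, c} \<subseteq> S" using vab c e by auto
    ultimately show ?thesis by (rule that)
  next
    case False
    then have e3: "e3 = {a, b}" using xy I vab by auto
    let ?Y = "{v, a, b}"
    have "card ?Y = 3" using vab by auto
    then have "{e. e \<subseteq> ?Y \<and> card e = 2} \<in> triple_configs n"
      unfolding triple_configs_def using vab by blast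
    moreover have "{e. e \<subseteq> ?Y \<and> card e = 2} \<subseteq> S"
    proof clarify
      fix f assume "f \<subseteq> ?Y" "card f = 2"
      then obtain x y where "f = {x, y}" "x \<noteq> y" "x \<in> ?Y" "y \<in> ?Y" by (auto simp: card_2_iff)
      then have "f = e1 \<or> f = e2 \<or> f = e3" unfolding vab e3 by auto
      then show "f \<in> S" using e by auto
    qed
    ultimately show ?thesis by (rule that)
  qed
qed

section \<open>Families through a star or a triangle\<close>

text \<open>Unlike in \<open>families_with_edges\<close>, further 2-sets may occur, so triples
  suffice to cover all families with three or more 2-sets.\<close>

definition families_through :: "nat \<Rightarrow> nat \<Rightarrow> nat set set \<Rightarrow> nat set set set" where
  "families_through n s T = {\<F> \<in> int_families s (upper_layers n 2). T \<subseteq> \<F>}"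

lemma families_throughD:
  assumes "\<F> \<in> families_through n s T" "Z \<in> \<F>"
  shows "Z \<subseteq> {1..n}" "2 \<le> card Z" "\<And>e. e \<in> T \<Longrightarrow> Z \<inter> e \<noteq> {}"
proof -
  have F: "intersecting \<F>" "\<F> \<subseteq> upper_layers n 2" "T \<subseteq> \<F>"
    using assms(1) by (auto simp: families_through_def int_families_def)
  show "Z \<subseteq> {1..n}" "2 \<le> card Z" using F(2) assms(2) by (auto simp: upper_layers_def)
  show "Z \<inter> e \<noteq> {}" if "e \<in> T" for e using intersectingD[OF F(1) assms(2)] F(3) that by blast
qed

lemma card_families_through_le:
  assumes T: "card T = 3" and fin: "finite \<A>"
    and sub: "\<And>\<F>. \<F> \<in> families_through n s T \<Longrightarrow> \<F> - T \<subseteq> \<A>"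
  shows "card (families_through n s T) \<le> card (int_families (s - 3) \<A>)"
proof (rule card_inj_on_le[of "\<lambda>\<F>. \<F> - T"])
  show "inj_on (\<lambda>\<F>. \<F> - T) (families_through n s T)"
    by (rule inj_onI) (auto simp: families_through_def)
  show "(\<lambda>\<F>. \<F> - T) ` families_through n s T \<subseteq> int_families (s - 3) \<A>"
  proof clarify
    fix \<F> assume F: "\<F> \<in> families_through n s T"
    have "finite T" using T by (simp add: card_ge_0_finite)
    then have "card (\<F> - T) = s - 3"
      using F T by (simp add: families_through_def int_families_def card_Diff_subset)
    then show "\<F> - T \<in> int_families (s - 3) \<A>"
      using F sub[OF F] intersecting_subset[of \<F> "\<F> - T"]
      by (auto simp: families_through_def int_families_def)
  qed
qed (rule finite_int_families[OF fin])

text \<open>A set meeting all three edges has one of four traces on the triangle, which leaves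
  \<open>2 ^ (n - 1)\<close> sets, edges included. Even if all of them met each other, the count
  would not exceed the lower bound \<open>binomial_le_star\<close> for stars.\<close>

lemma card_families_through_triangle:
  assumes "{a, b, c} \<subseteq> {1..n}" "a \<noteq> b" "a \<noteq> c" "b \<noteq> c"
  shows "card (families_through n s {{a, b}, {a, c}, {b, c}}) \<le> (2 ^ (n - 1) - 3) choose (s - 3)"
proof -
  let ?T = "{{a, b}, {a, c}, {b, c}}" and ?K = "{a, b, c}"
  let ?V = "{Z. Z \<subseteq> {1..n} \<and> Z \<inter> ?K \<in> insert ?K ?T}"
  have T: "card ?T = 3" using assms by (auto simp: card_insert_if doubleton_eq_iff)
  have K: "card ?K = 3" using assms by auto
  then have n: "3 \<le> n" using card_mono[OF _ assms(1)] by simp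
  have "card e = 2" if "e \<in> ?T" for e using that assms by auto
  then have "?K \<notin> ?T" using K by fastforce
  then have "card (insert ?K ?T) = 4" using T by simp
  then have "card ?V = 4 * 2 ^ (n - 3)" using assms(1) K by (subst card_subsets_trace) auto
  also have "\<dots> = 2 ^ (2 + (n - 3))" by (simp add: power_add)
  also have "2 + (n - 3) = n - 1" using n by simp
  finally have V: "card ?V = 2 ^ (n - 1)" .
  have fV: "finite ?V" by (rule finite_subset[of _ "Pow {1..n}"]) auto
  have "?T \<subseteq> ?V" using assms by auto
  then have VT: "card (?V - ?T) = 2 ^ (n - 1) - 3" using V T by (subst card_Diff_subset) auto
  have "card (families_through n s ?T) \<le> card (int_families (s - 3) (?V - ?T))"
  proof (rule card_families_through_le[OF T])
    show "finite (?V - ?T)" using fV by simp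
    fix \<F> assume F: "\<F> \<in> families_through n s ?T"
    show "\<F> - ?T \<subseteq> ?V - ?T"
    proof
      fix Z assume Z: "Z \<in> \<F> - ?T"
      then have "Z \<inter> {a, b} \<noteq> {}" "Z \<inter> {a, c} \<noteq> {}" "Z \<inter> {b, c} \<noteq> {}" "Z \<subseteq> {1..n}"
        using families_throughD(1)[OF F, of Z] families_throughD(3)[OF F, of Z "{a, b}"]
          families_throughD(3)[OF F, of Z "{a, c}"] families_throughD(3)[OF F, of Z "{b, c}"] by simp_all
      then have "Z \<inter> ?K \<in> insert ?K ?T" by auto
      then show "Z \<in> ?V - ?T" using Z \<open>Z \<subseteq> {1..n}\<close> by auto
    qed
  qed
  also have "\<dots> \<le> card {\<F>. \<F> \<subseteq> ?V - ?T \<and> card \<F> = s - 3}"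
    using fV by (intro card_mono) (auto simp: int_families_def)
  also have "\<dots> = (2 ^ (n - 1) - 3) choose (s - 3)" using fV VT by (subst n_subsets) auto
  finally show ?thesis .
qed

context star_config
begin

lemma card_families_through_star:
  "card (families_through n s {{v, a}, {v, b}, {v, c}}) \<le> nisf (s - 3) star_compatible"
  unfolding nisf_card
proof (rule card_families_through_le)
  show "card {{v, a}, {v, b}, {v, c}} = 3" using distinct by (auto simp: card_insert_if doubleton_eq_iff)
  show "finite star_compatible" by (rule finite_star_compatible)
  fix \<F> assume F: "\<F> \<in> families_through n s {{v, a}, {v, b}, {v, c}}"
  show "\<F> - {{v, a}, {v, b}, {v, c}} \<subseteq> star_compatible"
  proof
    fix Z assume Z: "Z \<in> \<F> - {{v, a}, {v, b}, {v, c}}"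
    then have "Z \<inter> {v, a} \<noteq> {}" "Z \<inter> {v, b} \<noteq> {}" "Z \<inter> {v, c} \<noteq> {}" "Z \<subseteq> {1..n}" "2 \<le> card Z"
      using families_throughD(1,2)[OF F, of Z] families_throughD(3)[OF F, of Z "{v, a}"]
        families_throughD(3)[OF F, of Z "{v, b}"] families_throughD(3)[OF F, of Z "{v, c}"] by simp_all
    then show "Z \<in> star_compatible" using Z by (auto simp: star_compatible_def)
  qed
qed

text \<open>Adjoin \<open>{v, a}\<close> and \<open>{v, b}\<close>: the compatible sets meet both
  and, having at least 3 elements, bring in no other 2-set.\<close>

lemma pair_compatible_le:
  "nisf k pair_compatible \<le> card (families_with_edges n (k + 2) {{v, a}, {v, b}})"
proof -
  define E where "E = {{v, a}, {v, b}}"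
  have E2: "card E = 2" using distinct by (auto simp: E_def doubleton_eq_iff)
  have disj: "\<F> \<inter> layer n 2 = {}" if "\<F> \<in> int_families k pair_compatible" for \<F>
    using that by (fastforce simp: int_families_def pair_compatible_def layer_def)
  have E: "E \<subseteq> layer n 2" using in_ground distinct by (auto simp: E_def layer_def)
  have "card (int_families k pair_compatible) \<le> card (families_with_edges n (k + 2) E)"
  proof (rule card_inj_on_le[of "\<lambda>\<F>. E \<union> \<F>"])
    show "inj_on (\<lambda>\<F>. E \<union> \<F>) (int_families k pair_compatible)"
    proof (rule inj_onI)
      fix \<F> \<G> assume F: "\<F> \<in> int_families k pair_compatible" "\<G> \<in> int_families k pair_compatible" "E \<union> \<F> = E \<union> \<G>"
      have "\<F> = (E \<union> \<F>) - layer n 2" "\<G> = (E \<union> \<G>) - layer n 2"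
        using disj[OF F(1)] disj[OF F(2)] E by blast+
      then show "\<F> = \<G>" using F(3) by simp
    qed
    show "(\<lambda>\<F>. E \<union> \<F>) ` int_families k pair_compatible \<subseteq> families_with_edges n (k + 2) E"
    proof clarify
      fix \<F> assume F: "\<F> \<in> int_families k pair_compatible"
      have "finite pair_compatible" by (rule finite_subset[of _ "Pow {1..n}"]) (auto simp: pair_compatible_def)
      then have fin: "finite \<F>" using F by (auto simp: int_families_def intro: finite_subset)
      have "E \<inter> \<F> = {}" using disj[OF F] E by blast
      then have "card (E \<union> \<F>) = k + 2" using fin F E2 by (subst card_Un_disjoint) (auto simp: int_families_def)
      moreover have "intersecting (E \<union> \<F>)"
      proof -
        have "Z \<inter> {v, a} \<noteq> {}" "Z \<inter> {v, b} \<noteq> {}" if "Z \<in> \<F>" for Z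
          using that F by (auto simp: int_families_def pair_compatible_def)
        moreover have "intersecting \<F>" using F by (simp add: int_families_def)
        ultimately show ?thesis by (simp add: E_def intersecting_insert)
      qed
      moreover have "E \<union> \<F> \<subseteq> upper_layers n 2"
        using F E by (fastforce simp: int_families_def pair_compatible_def upper_layers_def layer_def)
      moreover have "(E \<union> \<F>) \<inter> layer n 2 = E" using disj[OF F] E by blast
      ultimately show "E \<union> \<F> \<in> families_with_edges n (k + 2) E"
        by (simp add: families_with_edges_def int_families_def)
    qed
  qed (rule finite_families_with_edges)
  then show ?thesis by (simp add: nisf_card E_def)
qed

end

text \<open>A star is compared with its own pair \<open>{v, a}\<close>, \<open>{v, b}\<close>, a
  triangle with the star on 1, 2, 3, 4. By symmetry every such pair can be replaced by the one on
  the right.\<close>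

lemma families_through_small:
  assumes n: "21 \<le> n" and s: "2 \<le> s" "s \<le> 2 ^ (n - 1)" and T: "T \<in> triple_configs n"
  shows "triple_bound n * card (families_through n s T) < card (families_with_edges n s {{1, 2}, {1, 3}})"
proof -
  have main: "triple_bound n * card (families_through n s T) < card (families_with_edges n s {{1, 2}, {1, 3}})"
    if cfg: "star_config n v a b c" and le: "card (families_through n s T) \<le> nisf (s - 3) (star_config.star_compatible n v a b c)"
      and T3: "card T = 3" for v a b c
  proof -
    interpret star_config n v a b c by (rule cfg)
    have "{v, a, b} \<subseteq> {1..n}" "{1, 2, 3} \<subseteq> {1..n}" using in_ground n by auto
    then have K: "card (families_with_edges n s {{v, a}, {v, b}}) \<le> card (families_with_edges n s {{1, 2}, {1, 3}})"
      using distinct by (intro card_families_with_edges_pair_le) auto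
    have sk: "s - 2 + 2 = s" using s by simp
    have P: "nisf (s - 2) pair_compatible \<le> card (families_with_edges n s {{1, 2}, {1, 3}})"
      using pair_compatible_le[of "s - 2"] K unfolding sk by simp
    show ?thesis
    proof (cases "s = 2")
      \<comment> \<open>Here \<open>s - 3\<close> would be truncated. No family of two sets contains
        three, whereas the pair itself is counted on the right.\<close>
      case True
      have "families_through n s T = {}"
      proof (rule ccontr)
        assume "families_through n s T \<noteq> {}"
        then obtain \<F> where "T \<subseteq> \<F>" "card \<F> = 2" using True by (auto simp: families_through_def int_families_def)
        moreover from this have "finite \<F>" by (simp add: card_ge_0_finite)
        ultimately show False using T3 card_mono[of \<F> T] by simp
      qed
      moreover have "finite pair_compatible"
        by (rule finite_subset[of _ "Pow {1..n}"]) (auto simp: pair_compatible_def)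
      then have "nisf (s - 2) pair_compatible = 1" using True by (simp add: nisf_card int_families_0)
      ultimately show ?thesis using P by simp
    next
      case False
      then have s3: "s - 2 = Suc (s - 3)" using s by simp
      \<comment> \<open>The upper bound on \<open>s\<close> enters here: it guarantees a star family
        to start from, as \<open>pair_beats_star\<close> requires.\<close>
      have "0 < (2 ^ (n - 1) - 3) choose (s - 3)" using s(2) by (simp add: zero_less_binomial_iff)
      then have "0 < nisf (s - 3) star_compatible" using binomial_le_star[of "s - 3"] by linarith
      then have "triple_bound n * nisf (s - 3) star_compatible < nisf (s - 2) pair_compatible"
        unfolding s3 by (rule pair_beats_star)
      moreover have "triple_bound n * card (families_through n s T) \<le> triple_bound n * nisf (s - 3) star_compatible"
        using le triple_bound_ge[OF n] by (intro mult_left_mono) auto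
      ultimately show ?thesis using P by linarith
    qed
  qed
  show ?thesis
  proof (cases rule: triple_configs_cases[OF T])
    case (1 v a b c)
    then interpret star_config n v a b c using n by unfold_locales auto
    have "card T = 3" using 1 by (auto simp: card_insert_if doubleton_eq_iff)
    moreover have "card (families_through n s T) \<le> nisf (s - 3) star_compatible"
      unfolding 1(1) by (rule card_families_through_star)
    ultimately show ?thesis using main star_config_axioms by blast
  next
    case (2 a b c)
    interpret star_config n 1 2 3 4 using n by unfold_locales auto
    have "card T = 3" using 2 by (auto simp: card_insert_if doubleton_eq_iff)
    moreover have "card (families_through n s T) \<le> nisf (s - 3) star_compatible"
      unfolding 2(1) using card_families_through_triangle[of a b c n s] 2 binomial_le_star[of "s - 3"] by linarith
    ultimately show ?thesis using main star_config_axioms by blast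
  qed
qed

section \<open>Expansion by the number of 2-sets\<close>

lemma num_intersecting_pairs_eq:
  assumes "\<B> \<subseteq> layer n 2"
  shows "num_intersecting_pairs \<B> = card {S. S \<subseteq> \<B> \<and> card S = 2 \<and> intersecting S}"
proof -
  have ne: "B \<noteq> {}" if "B \<in> \<B>" for B using that assms by (auto simp: layer_def)
  have "{{B, B'} | B B'. B \<in> \<B> \<and> B' \<in> \<B> \<and> B \<noteq> B' \<and> B \<inter> B' \<noteq> {}}
      = {S. S \<subseteq> \<B> \<and> card S = 2 \<and> intersecting S}" (is "?l = ?r")
  proof
    show "?l \<subseteq> ?r"
    proof
      fix S assume "S \<in> ?l"
      then obtain B B' where "S = {B, B'}" "B \<in> \<B>" "B' \<in> \<B>" "B \<noteq> B'" "B \<inter> B' \<noteq> {}" by blast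
      then show "S \<in> ?r" using ne[of B] ne[of B'] by (simp add: intersecting_def Int_commute)
    qed
    show "?r \<subseteq> ?l"
    proof
      fix S assume "S \<in> ?r"
      then have S: "S \<subseteq> \<B>" "card S = 2" "intersecting S" by auto
      then obtain B B' where "S = {B, B'}" "B \<noteq> B'" by (auto simp: card_2_iff)
      moreover from this have "B \<inter> B' \<noteq> {}" using intersectingD[OF S(3)] by simp
      ultimately show "S \<in> ?l" using S(1) by blast
    qed
  qed
  then show ?thesis by (simp add: num_intersecting_pairs_def)
qed

lemma nisf_split:
  assumes "\<B> \<subseteq> layer n 2"
  shows "nisf s (upper_layers n 3 \<union> \<B>) = (\<Sum>S\<in>Pow \<B>. card (families_with_edges n s S))"
proof -
  have fin: "finite \<B>" by (rule finite_subset[OF assms finite_layer])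
  have "int_families s (upper_layers n 3 \<union> \<B>) = (\<Union>S\<in>Pow \<B>. families_with_edges n s S)"
    using assms upper_layers_disjoint[of n] unfolding families_with_edges_def int_families_def upper_layers_2
    by blast
  moreover have "card (\<Union>S\<in>Pow \<B>. families_with_edges n s S) = (\<Sum>S\<in>Pow \<B>. card (families_with_edges n s S))"
    using fin by (intro card_UN_disjoint) (auto simp: finite_families_with_edges, auto simp: families_with_edges_def)
  ultimately show ?thesis by (simp add: nisf_card)
qed

text \<open>Only the contribution of three or more edges depends on the structure of \<open>\<B>\<close> beyond its size and
  its number of intersecting pairs.\<close>

lemma nisf_expansion:
  assumes n: "21 \<le> n" and B: "\<B> \<subseteq> layer n 2"
  shows "nisf s (upper_layers n 3 \<union> \<B>) = card (families_with_edges n s {})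
    + card \<B> * card (families_with_edges n s {{1, 2}})
    + num_intersecting_pairs \<B> * card (families_with_edges n s {{1, 2}, {1, 3}})
    + (\<Sum>S | S \<subseteq> \<B> \<and> 3 \<le> card S. card (families_with_edges n s S))"
proof -
  let ?q = "\<lambda>S. card (families_with_edges n s S)"
  have fin: "finite \<B>" by (rule finite_subset[OF B finite_layer])
  have fS: "finite S" if "S \<subseteq> \<B>" for S using that fin finite_subset by auto
  let ?P = "\<lambda>k. {S. S \<subseteq> \<B> \<and> card S = k}" and ?P3 = "{S. S \<subseteq> \<B> \<and> 3 \<le> card S}"
  have P0: "?P 0 = {{}}" using fS by auto
  have "card S = 0 \<or> card S = 1 \<or> card S = 2 \<or> 3 \<le> card S" for S :: "nat set set" by arith
  then have split: "Pow \<B> = ?P 0 \<union> (?P 1 \<union> (?P 2 \<union> ?P3))" by blast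
  have finP: "finite (?P k)" "finite ?P3" for k using fin by simp_all
  have "(\<Sum>S\<in>Pow \<B>. ?q S) = sum ?q (?P 0) + sum ?q (?P 1 \<union> (?P 2 \<union> ?P3))"
    unfolding split using finP by (intro sum.union_disjoint) auto
  also have "sum ?q (?P 1 \<union> (?P 2 \<union> ?P3)) = sum ?q (?P 1) + sum ?q (?P 2 \<union> ?P3)"
    using finP by (intro sum.union_disjoint) auto
  also have "sum ?q (?P 2 \<union> ?P3) = sum ?q (?P 2) + sum ?q ?P3"
    using finP by (intro sum.union_disjoint) auto
  finally have sum: "(\<Sum>S\<in>Pow \<B>. ?q S) = ?q {} + (sum ?q (?P 1) + (sum ?q (?P 2) + sum ?q ?P3))"
    unfolding P0 by simp
  have n3: "{1, 2, 3} \<subseteq> {1..n}" using n by auto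
  have "sum ?q (?P 1) = (\<Sum>S\<in>?P 1. ?q {{1, 2}})"
  proof (rule sum.cong)
    fix S assume "S \<in> ?P 1"
    then obtain e where e: "S = {e}" "e \<in> layer n 2" using B by (auto simp: card_1_singleton_iff)
    obtain x y where xy: "e = {x, y}" "x \<noteq> y" "x \<in> {1..n}" "y \<in> {1..n}" using layer_2_cases[OF e(2)] .
    \<comment> \<open>A third point is sought because the symmetry lemma moves three points at
      once.\<close>
    have "\<not> {1..n} \<subseteq> {x, y}"
    proof
      assume "{1..n} \<subseteq> {x, y}"
      then have "card {1..n} \<le> card {x, y}" by (intro card_mono) auto
      then show False using n xy by simp
    qed
    then obtain z where z: "z \<in> {1..n}" "z \<notin> {x, y}" by blast
    have "?q {{x, y}} \<le> ?q {{1, 2}}"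
      by (rule card_families_with_edges_pair_le(1)[where b = z and b' = 3]) (use xy z n3 in auto)
    moreover have "?q {{1, 2}} \<le> ?q {{x, y}}"
      by (rule card_families_with_edges_pair_le(1)[where b = 3 and b' = z]) (use xy z n3 in auto)
    ultimately show "?q S = ?q {{1, 2}}" unfolding e xy by simp
  qed simp
  also have "\<dots> = card \<B> * ?q {{1, 2}}" using n_subsets[OF fin, of 1] by simp
  finally have one: "sum ?q (?P 1) = card \<B> * ?q {{1, 2}}" .
  have "sum ?q (?P 2) = (\<Sum>S\<in>{S. S \<subseteq> \<B> \<and> card S = 2 \<and> intersecting S}. ?q S)"
  proof (rule sum.mono_neutral_right)
    show "\<forall>S\<in>?P 2 - {S. S \<subseteq> \<B> \<and> card S = 2 \<and> intersecting S}. ?q S = 0"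
    proof
      fix S assume S: "S \<in> ?P 2 - {S. S \<subseteq> \<B> \<and> card S = 2 \<and> intersecting S}"
      then have "families_with_edges n s S = {}"
        by (auto simp: families_with_edges_def int_families_def dest: intersecting_subset)
      then show "?q S = 0" by simp
    qed
  qed (use finP in auto)
  also have "\<dots> = (\<Sum>S\<in>{S. S \<subseteq> \<B> \<and> card S = 2 \<and> intersecting S}. ?q {{1, 2}, {1, 3}})"
  proof (rule sum.cong)
    fix S assume S: "S \<in> {S. S \<subseteq> \<B> \<and> card S = 2 \<and> intersecting S}"
    then obtain e e' where e: "S = {e, e'}" "e \<noteq> e'" by (auto simp: card_2_iff)
    then have "e \<in> layer n 2" "e' \<in> layer n 2" "e \<inter> e' \<noteq> {}" using S B by (auto simp: intersecting_insert)
    then obtain v a b where vab: "e = {v, a}" "e' = {v, b}" "v \<noteq> a" "v \<noteq> b" "a \<noteq> b" "{v, a, b} \<subseteq> {1..n}"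
      using layer_2_meeting_cases e(2) by metis
    have "?q {{v, a}, {v, b}} \<le> ?q {{1, 2}, {1, 3}}"
      by (rule card_families_with_edges_pair_le(2)) (use vab n3 in auto)
    moreover have "?q {{1, 2}, {1, 3}} \<le> ?q {{v, a}, {v, b}}"
      by (rule card_families_with_edges_pair_le(2)) (use vab n3 in auto)
    ultimately show "?q S = ?q {{1, 2}, {1, 3}}" unfolding e vab by simp
  qed simp
  also have "\<dots> = num_intersecting_pairs \<B> * ?q {{1, 2}, {1, 3}}"
    using num_intersecting_pairs_eq[OF B] by simp
  finally have two: "sum ?q (?P 2) = num_intersecting_pairs \<B> * ?q {{1, 2}, {1, 3}}" .
  show ?thesis using nisf_split[OF B, of s] sum one two by simp
qed

text \<open>A union bound over stars and triangles: there are at most \<open>triple_bound n\<close>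
  of them, and each accounts for less than the fraction \<open>1 / triple_bound n\<close> of the
  right side.\<close>

lemma many_edges_small:
  assumes n: "21 \<le> n" and s: "2 \<le> s" "s \<le> 2 ^ (n - 1)" and B: "\<B> \<subseteq> layer n 2"
  shows "(\<Sum>S | S \<subseteq> \<B> \<and> 3 \<le> card S. card (families_with_edges n s S))
    < card (families_with_edges n s {{1, 2}, {1, 3}})" (is "?E < ?k")
proof -
  let ?P = "{S. S \<subseteq> \<B> \<and> 3 \<le> card S}"
  have fin: "finite \<B>" by (rule finite_subset[OF B finite_layer])
  have ft: "finite (families_through n s T)" for T
    by (simp add: families_through_def finite_int_families finite_upper_layers)
  have "?E = card (\<Union>S\<in>?P. families_with_edges n s S)"
    using fin by (intro card_UN_disjoint[symmetric])
      (auto simp: finite_families_with_edges, auto simp: families_with_edges_def)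
  also have "\<dots> \<le> card (\<Union>T\<in>triple_configs n. families_through n s T)"
  proof (rule card_mono)
    show "finite (\<Union>T\<in>triple_configs n. families_through n s T)" using finite_triple_configs ft by auto
    show "(\<Union>S\<in>?P. families_with_edges n s S) \<subseteq> (\<Union>T\<in>triple_configs n. families_through n s T)"
    proof clarify
      fix S \<F> assume S: "S \<subseteq> \<B>" "3 \<le> card S" and F: "\<F> \<in> families_with_edges n s S"
      then have "intersecting S" "S \<subseteq> \<F>"
        by (auto simp: families_with_edges_def int_families_def intro: intersecting_subset)
      then obtain T where "T \<in> triple_configs n" "T \<subseteq> S"
        using contains_triple_config[of S n] S B by blast
      then show "\<F> \<in> (\<Union>T\<in>triple_configs n. families_through n s T)"
        using F \<open>S \<subseteq> \<F>\<close> by (auto simp: families_through_def families_with_edges_def)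
    qed
  qed
  also have "\<dots> \<le> (\<Sum>T\<in>triple_configs n. card (families_through n s T))"
    by (rule card_UN_le[OF finite_triple_configs])
  finally have E: "?E \<le> (\<Sum>T\<in>triple_configs n. card (families_through n s T))" .
  have tb: "0 < triple_bound n" using triple_bound_ge[OF n] by linarith
  \<comment> \<open>Strictness of the summed inequality needs at least one summand.\<close>
  have ne: "triple_configs n \<noteq> {}"
  proof -
    have "{1, 2, 3} \<in> {Y. Y \<subseteq> {1..n} \<and> card Y = 3}" using n by auto
    then show ?thesis unfolding triple_configs_def by blast
  qed
  have "triple_bound n * real ?E \<le> triple_bound n * real (\<Sum>T\<in>triple_configs n. card (families_through n s T))"
    using of_nat_mono[OF E] tb by (intro mult_left_mono) auto
  also have "\<dots> = (\<Sum>T\<in>triple_configs n. triple_bound n * card (families_through n s T))"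
    by (simp add: sum_distrib_left)
  also have "\<dots> < (\<Sum>T\<in>triple_configs n. real ?k)"
    using ne by (intro sum_strict_mono finite_triple_configs families_through_small n s)
  also have "\<dots> = real (card (triple_configs n)) * real ?k" by simp
  also have "\<dots> \<le> triple_bound n * real ?k"
    by (intro mult_right_mono card_triple_configs n) simp
  finally show ?thesis using tb by (simp only: mult_less_cancel_left_pos of_nat_less_iff)
qed

section \<open>Sizes, and the final comparison\<close>

lemma card_upper_layers: "card (upper_layers n r) = (\<Sum>k=r..n. n choose k)"
proof -
  have "upper_layers n r = (\<Union>k\<in>{r..n}. {X. X \<subseteq> {1..n} \<and> card X = k})"
    using card_mono[of "{1..n}"] by (fastforce simp: upper_layers_def)
  moreover have "card (\<Union>k\<in>{r..n}. {X. X \<subseteq> {1..n} \<and> card X = k}) = (\<Sum>k=r..n. card {X. X \<subseteq> {1..n} \<and> card X = k})"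
    by (intro card_UN_disjoint) auto
  ultimately show ?thesis by (simp add: n_subsets)
qed

theorem theorem3:
  fixes n s i :: nat and \<A> \<B> :: "nat set set"
  assumes "n \<ge> 21" and "2 \<le> s" and "s \<le> 2 ^ (n - 1)" and "i \<le> n choose 2"
    and "\<A> \<subseteq> Pow {1..n}"
    and "card \<A> = (\<Sum>k=3..n. n choose k) + i"
    and "\<B> \<subseteq> layer n 2" and "\<A> = upper_layers n 3 \<union> \<B>"
    and "\<And>\<A>' \<B>'. \<lbrakk>\<A>' \<subseteq> Pow {1..n}; card \<A>' = (\<Sum>k=3..n. n choose k) + i;
           \<B>' \<subseteq> layer n 2; \<A>' = upper_layers n 3 \<union> \<B>'\<rbrakk>
         \<Longrightarrow> num_intersecting_subfamilies s \<A>' \<le> num_intersecting_subfamilies s \<A>"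
  shows "\<B> \<subseteq> layer n 2 \<and> card \<B> = i \<and>
    (\<forall>\<B>'. \<B>' \<subseteq> layer n 2 \<and> card \<B>' = i
        \<longrightarrow> num_intersecting_pairs \<B>' \<le> num_intersecting_pairs \<B>)"
proof (intro conjI allI impI)
  note n = assms(1) and s = assms(2,3)
  have card_Un: "card (upper_layers n 3 \<union> \<C>) = (\<Sum>k=3..n. n choose k) + card \<C>"
    if "\<C> \<subseteq> layer n 2" for \<C>
  proof -
    have "finite \<C>" by (rule finite_subset[OF that finite_layer])
    then show ?thesis
      using that upper_layers_disjoint[of n] finite_upper_layers[of n 3]
      by (subst card_Un_disjoint) (auto simp: card_upper_layers)
  qed
  show cardB: "card \<B> = i" using card_Un[OF assms(7)] assms(6,8) by simp
  show "\<B> \<subseteq> layer n 2" by (rule assms(7))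
  fix \<B>' assume B': "\<B>' \<subseteq> layer n 2 \<and> card \<B>' = i"
  let ?k = "card (families_with_edges n s {{1, 2}, {1, 3}})"
  have "nisf s (upper_layers n 3 \<union> \<B>') \<le> nisf s (upper_layers n 3 \<union> \<B>)"
    using assms(9)[of "upper_layers n 3 \<union> \<B>'" \<B>'] B' card_Un[of \<B>'] assms(8)
    by (auto simp: upper_layers_def layer_def)
  \<comment> \<open>The first two terms of the expansions agree because the sizes do. The last term
    is dropped for \<B>' and is below \<open>?k\<close> for \<B>, so not even one extra intersecting
    pair is possible in \<B>'.\<close>
  then have "num_intersecting_pairs \<B>' * ?k < num_intersecting_pairs \<B> * ?k + ?k"
    using many_edges_small[OF n s assms(7)] nisf_expansion[OF n assms(7), of s]
      nisf_expansion[OF n, of \<B>' s] B' cardB by simp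
  then have "num_intersecting_pairs \<B>' * ?k < Suc (num_intersecting_pairs \<B>) * ?k" by simp
  then show "num_intersecting_pairs \<B>' \<le> num_intersecting_pairs \<B>"
    by (metis less_Suc_eq_le mult_less_cancel2)
qed

end
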